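(* Let $n\ge 2$ be an integer, let $\Phi=A_1\times I_2(n)\subset\mathbb{R}^3$ with reflection group $W$ (of order $4n$), and fix a Weyl chamber of $W$. The three planes bounding this chamber divide $\mathbb{R}^3$ into $8$ open cones forming $4$ antipodal pairs, and the two cones of each antipodal pair contain equally many Weyl chambers of $W$. Choosing one cone from each antipodal pair, the numbers of Weyl chambers contained in the four chosen cones form the multiset $\{1,\,1,\,n-1,\,n-1\}$, so that $$4n = 2\bigl(1+(n-1)+1+(n-1)\bigr),$$ and this multiset is exactly the multiset of exponents of the four-dimensional root system $I_2(n)\times I_2(n)$.
   Context: $I_2(n)$ is the planar root system whose reflection group is the symmetry group of the regular $n$-gon (dihedral of order $2n$), with simple roots $e_1$ and $-\cos\frac{\pi}{n}e_1+\sin\frac{\pi}{n}e_2$. $A_1\times I_2(n)$ denotes the three-dimensional root system that is the orthogonal union of $A_1=\{\pm e\}$ ($e$ a unit vector) and $I_2(n)$. $I_2(n)\times I_2(n)$ denotes the four-dimensional root system that is the orthogonal union of two copies of $I_2(n)$ in $\mathbb{R}^2\oplus\mathbb{R}^2$. The reflection group of a root system is the group generated by the orthogonal reflections in the hyperplanes normal to its roots. The Weyl chambers are the connected components of the complement of the union of these hyperplanes. Exponents: let $w$ be a Coxeter element of the root system, i.e. the product of all simple reflections in some order, and let $h$ be the Coxeter number; for $I_2(n)\times I_2(n)$, $w$ has order $h=n$. The exponents are the integers $m_i$ with $0\le m_i<h$, counted with multiplicity, such that $\exp(2\pi i\, m_i/h)$ are the complex eigenvalues of $w$. *)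

theory Defs
  imports "HOL-Analysis.Analysis" "HOL-Library.Multiset"
    "HOL-Computational_Algebra.Polynomial"
begin

definition reflection :: "'a::real_inner \<Rightarrow> 'a \<Rightarrow> 'a" where
  "reflection a x = x - (2 * (x \<bullet> a) / (a \<bullet> a)) *\<^sub>R a"

text \<open>The group generated by the reflections in the elements of \<open>A\<close>. Reflections are involutions,
  so closing under composition already closes under inverses.\<close>

inductive_set reflection_group :: "'a::real_inner set \<Rightarrow> ('a \<Rightarrow> 'a) set"
  for A :: "'a::real_inner set" where
  id: "id \<in> reflection_group A"
| step: "a \<in> A \<Longrightarrow> w \<in> reflection_group A \<Longrightarrow> reflection a \<circ> w \<in> reflection_group A"

definition root_system :: "'a::real_inner set \<Rightarrow> 'a set" where
  "root_system \<Delta> = {w a |w a. w \<in> reflection_group \<Delta> \<and> a \<in> \<Delta>}"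

definition I2_simple :: "nat \<Rightarrow> (real^2) set" where
  "I2_simple n = {axis 1 1, - cos (pi / n) *\<^sub>R axis 1 1 + sin (pi / n) *\<^sub>R axis 2 1}"

definition I2 :: "nat \<Rightarrow> (real^2) set" where
  "I2 n = root_system (I2_simple n)"

definition A1_I2 :: "nat \<Rightarrow> (real^3) set" where
  "A1_I2 n = {axis 3 1, - axis 3 1} \<union> (\<lambda>v. vector [v $ 1, v $ 2, 0]) ` I2 n"

definition plane12 :: "real^2 \<Rightarrow> real^4" where
  "plane12 v = vector [v $ 1, v $ 2, 0, 0]"

definition plane34 :: "real^2 \<Rightarrow> real^4" where
  "plane34 v = vector [0, 0, v $ 1, v $ 2]"

definition I2_I2 :: "nat \<Rightarrow> (real^4) set" where
  "I2_I2 n = plane12 ` I2 n \<union> plane34 ` I2 n"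

definition I2_I2_simple :: "nat \<Rightarrow> (real^4) set" where
  "I2_I2_simple n = plane12 ` I2_simple n \<union> plane34 ` I2_simple n"

lemma vector_4:
  "(vector [x, y, z, w] :: 'a::zero^4) $ 1 = x"
  "(vector [x, y, z, w] :: 'a::zero^4) $ 2 = y"
  "(vector [x, y, z, w] :: 'a::zero^4) $ 3 = z"
  "(vector [x, y, z, w] :: 'a::zero^4) $ 4 = w"
  unfolding vector_def by simp_all

lemma reflection_plane:
  "reflection (plane12 a) (plane12 x) = plane12 (reflection a x)"
  "reflection (plane34 a) (plane34 x) = plane34 (reflection a x)"
  "reflection (plane12 a) (plane34 x) = plane34 x"
  "reflection (plane34 a) (plane12 x) = plane12 x"
  by (simp_all add: reflection_def plane12_def plane34_def vec_eq_iff forall_4 inner_vec_def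
      sum_4 sum_2 vector_4)

lemma reflection_group_I2_I2_simple:
  assumes "w \<in> reflection_group (I2_I2_simple n)"
  shows "\<exists>u\<in>reflection_group (I2_simple n). \<exists>v\<in>reflection_group (I2_simple n).
    \<forall>x. w (plane12 x) = plane12 (u x) \<and> w (plane34 x) = plane34 (v x)"
  using assms
proof (induction rule: reflection_group.induct)
  case id
  show ?case
    by (rule bexI[of _ id] | simp add: reflection_group.id)+
next
  case (step a w)
  then obtain u v where uv: "u \<in> reflection_group (I2_simple n)" "v \<in> reflection_group (I2_simple n)"
    "\<And>x. w (plane12 x) = plane12 (u x)" "\<And>x. w (plane34 x) = plane34 (v x)"
    by blast
  from step.hyps(1) consider b where "b \<in> I2_simple n" "a = plane12 b"
    | b where "b \<in> I2_simple n" "a = plane34 b"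
    unfolding I2_I2_simple_def by blast
  then show ?case
  proof cases
    case 1
    then show ?thesis
      using uv by (intro bexI[of _ "reflection b \<circ> u"] bexI[of _ v])
        (auto simp: reflection_plane intro: reflection_group.step)
  next
    case 2
    then show ?thesis
      using uv by (intro bexI[of _ u] bexI[of _ "reflection b \<circ> v"])
        (auto simp: reflection_plane intro: reflection_group.step)
  qed
qed

lemma reflection_group_lift:
  assumes "u \<in> reflection_group (I2_simple n)"
  shows "\<exists>w\<in>reflection_group (I2_I2_simple n). \<forall>x. w (plane12 x) = plane12 (u x)"
    and "\<exists>w\<in>reflection_group (I2_I2_simple n). \<forall>x. w (plane34 x) = plane34 (u x)"
  using assms
proof (induction rule: reflection_group.induct)
  case id
  {
    case 1
    show ?case by (rule bexI[of _ id] | simp add: reflection_group.id)+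
  next
    case 2
    show ?case by (rule bexI[of _ id] | simp add: reflection_group.id)+
  }
next
  case (step a u)
  {
    case 1
    from step.IH(1) obtain w where "w \<in> reflection_group (I2_I2_simple n)"
      "\<And>x. w (plane12 x) = plane12 (u x)" by blast
    with step.hyps(1) show ?case
      by (intro bexI[of _ "reflection (plane12 a) \<circ> w"])
        (auto simp: reflection_plane I2_I2_simple_def intro!: reflection_group.step)
  next
    case 2
    from step.IH(2) obtain w where "w \<in> reflection_group (I2_I2_simple n)"
      "\<And>x. w (plane34 x) = plane34 (u x)" by blast
    with step.hyps(1) show ?case
      by (intro bexI[of _ "reflection (plane34 a) \<circ> w"])
        (auto simp: reflection_plane I2_I2_simple_def intro!: reflection_group.step)
  }
qed

lemma root_system_I2_I2_simple: "root_system (I2_I2_simple n) = I2_I2 n"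
proof (intro equalityI subsetI)
  fix r assume "r \<in> root_system (I2_I2_simple n)"
  then obtain w a where wa: "r = w a" "w \<in> reflection_group (I2_I2_simple n)" "a \<in> I2_I2_simple n"
    unfolding root_system_def by blast
  with reflection_group_I2_I2_simple[OF wa(2)] show "r \<in> I2_I2 n"
    unfolding I2_I2_simple_def I2_I2_def I2_def root_system_def by fastforce
next
  fix r assume "r \<in> I2_I2 n"
  then consider u a where "r = plane12 (u a)" "u \<in> reflection_group (I2_simple n)" "a \<in> I2_simple n"
    | u a where "r = plane34 (u a)" "u \<in> reflection_group (I2_simple n)" "a \<in> I2_simple n"
    unfolding I2_I2_def I2_def root_system_def by blast
  then show "r \<in> root_system (I2_I2_simple n)"
  proof cases
    case 1
    from reflection_group_lift(1)[OF 1(2)] obtain w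
      where "w \<in> reflection_group (I2_I2_simple n)" "w (plane12 a) = r"
      using 1(1) by metis
    moreover have "plane12 a \<in> I2_I2_simple n"
      using 1(3) by (simp add: I2_I2_simple_def)
    ultimately show ?thesis
      unfolding root_system_def by blast
  next
    case 2
    from reflection_group_lift(2)[OF 2(2)] obtain w
      where "w \<in> reflection_group (I2_I2_simple n)" "w (plane34 a) = r"
      using 2(1) by metis
    moreover have "plane34 a \<in> I2_I2_simple n"
      using 2(3) by (simp add: I2_I2_simple_def)
    ultimately show ?thesis
      unfolding root_system_def by blast
  qed
qed

definition root_hyperplanes :: "'a::real_inner set \<Rightarrow> 'a set set" where
  "root_hyperplanes \<Phi> = (\<lambda>a. {x. x \<bullet> a = 0}) ` \<Phi>"

definition regions :: "'a::real_inner set set \<Rightarrow> 'a set set" where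
  "regions \<H> = components (- \<Union>\<H>)"

definition weyl_chambers :: "'a::real_inner set \<Rightarrow> 'a set set" where
  "weyl_chambers \<Phi> = regions (root_hyperplanes \<Phi>)"

text \<open>A hyperplane of the arrangement bounds \<open>C\<close> if it carries a facet of \<open>C\<close>. Meeting the closure
  of \<open>C\<close> would not suffice: every root hyperplane contains the origin.\<close>

definition walls :: "'a::real_inner set \<Rightarrow> 'a set \<Rightarrow> 'a set set" where
  "walls \<Phi> C = {H \<in> root_hyperplanes \<Phi>. affine hull (H \<inter> closure C) = H}"

definition num_chambers :: "'a::real_inner set \<Rightarrow> 'a set \<Rightarrow> nat" where
  "num_chambers \<Phi> K = card {D \<in> weyl_chambers \<Phi>. D \<subseteq> K}"

definition coxeter_elements :: "'a::real_inner set \<Rightarrow> ('a \<Rightarrow> 'a) set" where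
  "coxeter_elements \<Delta> = {foldr (\<lambda>a w. reflection a \<circ> w) as id |as. distinct as \<and> set as = \<Delta>}"

definition map_order :: "('a \<Rightarrow> 'a) \<Rightarrow> nat" where
  "map_order w = (LEAST k. 0 < k \<and> w ^^ k = id)"

text \<open>The characteristic polynomial of (the complexification of) a real linear map.\<close>

definition charpoly :: "(real^'n \<Rightarrow> real^'n) \<Rightarrow> complex poly" where
  "charpoly w = det (\<chi> i j. (if i = j then [:0, 1:] else 0) - [:complex_of_real (matrix w $ i $ j):])"

text \<open>For a Coxeter element \<open>w\<close>, with Coxeter number \<open>h\<close> the order of \<open>w\<close>: \<open>m < h\<close> occurs as often as
  \<open>exp (2 \<pi> i m / h)\<close> is an eigenvalue of \<open>w\<close>.\<close>

definition exponents :: "(real^'n \<Rightarrow> real^'n) \<Rightarrow> nat multiset" where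
  "exponents w = (let h = map_order w in
     \<Sum>m<h. replicate_mset (order (exp (2 * pi * \<i> * m / h)) (charpoly w)) m)"

end

theory Submission
  imports Defs
begin

text \<open>The regions of a hyperplane arrangement are its nonempty sign cells. In \<open>\<real>\<^sup>3\<close> a Weyl chamber of
  \<open>A\<^sub>1 \<times> I\<^sub>2(n)\<close> is one of the \<open>2 n\<close> sectors of angle \<open>\<pi> / n\<close> in the plane of \<open>I\<^sub>2(n)\<close> times a half-line.
  Its walls are the plane of \<open>I\<^sub>2(n)\<close> and the two vertical planes bounding the sector. These two cut
  the horizontal plane into angles of \<open>1\<close>, \<open>n - 1\<close>, \<open>1\<close>, \<open>n - 1\<close> sectors, which gives the count in each
  half-space. A Coxeter element of \<open>I\<^sub>2(n) \<times> I\<^sub>2(n)\<close> rotates each of the two planes by \<open>\<plusminus> 2 \<pi> / n\<close>, so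
  it has order \<open>n\<close> and its eigenvalues are \<open>exp (\<plusminus> 2 \<pi> i / n)\<close>, each occurring twice.\<close>

section \<open>Regions of hyperplane arrangements\<close>

text \<open>At horizontal angle t, root \<open>k\<close> has the sign of sin(t - k pi/n). This sign
  is constant on a sector and equals the parity of \<open>(j - k) div n\<close> on sector
  \<open>j\<close>, so all questions about chambers become integer division. The definition of a
  wall is the main obstacle: every vertical root plane meets the closed chamber at least in a
  vertical half-line, so planes other than the bounding ones can be excluded only by measuring this
  intersection. A linear relation between the roots \<open>j\<close>, \<open>j + 1\<close> and
  \<open>k\<close> does so. The numbers 1 and n - 1 come from two windows: root \<open>j\<close> and
  root \<open>j + 1\<close> are each positive on n consecutive sectors out of a cycle of 2n, and the
  windows are offset by one sector. For the exponents, the order of the simple reflections affects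
  only the sense of rotation, independently in the two planes. Reversing the sense swaps two
  conjugate eigenvalues, so all Coxeter elements give the same multiset. For n = 2 the values 1 and
  n - 1 coincide and their multiplicities add.\<close>

definition cell :: "'a::real_inner set \<Rightarrow> 'a \<Rightarrow> 'a set" where
  "cell A x = {y. \<forall>a\<in>A. sgn (y \<bullet> a) = sgn (x \<bullet> a)}"

lemma sgn_eq_iff_mult_pos:
  fixes r s :: real
  assumes "s \<noteq> 0"
  shows "sgn r = sgn s \<longleftrightarrow> 0 < r * s"
  using assms by (auto simp: sgn_if zero_less_mult_iff)

text \<open>For a base point off all hyperplanes, membership becomes one strict linear inequality
  per element of \<open>A\<close>; convexity, openness and the closure are read off from this
  form.\<close>

lemma cell_eq:
  assumes "\<forall>a\<in>A. x \<bullet> a \<noteq> 0"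
  shows "cell A x = {y. \<forall>a\<in>A. 0 < (y \<bullet> a) * (x \<bullet> a)}"
  using assms by (auto simp: cell_def sgn_eq_iff_mult_pos)

lemma cell_cong: "y \<in> cell A x \<Longrightarrow> cell A y = cell A x"
  by (auto simp: cell_def)

lemma self_in_cell: "x \<in> cell A x"
  by (simp add: cell_def)

lemma convex_cell:
  assumes "\<forall>a\<in>A. x \<bullet> a \<noteq> 0"
  shows "convex (cell A x)"
  unfolding cell_eq[OF assms]
proof (rule convexI, safe)
  fix y z a and u v :: real
  assume *: "\<forall>a\<in>A. 0 < (y \<bullet> a) * (x \<bullet> a)" "\<forall>a\<in>A. 0 < (z \<bullet> a) * (x \<bullet> a)"
    "0 \<le> u" "0 \<le> v" "u + v = 1" "a \<in> A"
  have "0 < u * ((y \<bullet> a) * (x \<bullet> a)) + v * ((z \<bullet> a) * (x \<bullet> a))"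
  proof (cases "u = 0")
    case True
    with * show ?thesis by simp
  next
    case False
    with * show ?thesis by (intro add_pos_nonneg) (auto simp: less_imp_le)
  qed
  then show "0 < ((u *\<^sub>R y + v *\<^sub>R z) \<bullet> a) * (x \<bullet> a)"
    by (simp add: inner_add_left algebra_simps)
qed

text \<open>A cell is convex, hence connected. Conversely, a functional that changed sign on a
  connected set would vanish somewhere on it, by the intermediate value theorem.\<close>

lemma connected_component_hyperplanes:
  assumes "\<forall>a\<in>A. x \<bullet> a \<noteq> 0"
  shows "connected_component_set {y. \<forall>a\<in>A. y \<bullet> a \<noteq> 0} x = cell A x"
    (is "connected_component_set ?U x = _")
proof
  show "cell A x \<subseteq> connected_component_set ?U x"
  proof (rule connected_component_maximal)
    show "connected (cell A x)"
      using convex_cell[OF assms] by (rule convex_connected)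
    show "cell A x \<subseteq> ?U"
      using assms by (auto simp: cell_eq)
  qed (rule self_in_cell)
  show "connected_component_set ?U x \<subseteq> cell A x"
  proof
    fix y assume y: "y \<in> connected_component_set ?U x"
    have "0 < (y \<bullet> a) * (x \<bullet> a)" if a: "a \<in> A" for a
    proof (rule ccontr)
      let ?T = "connected_component_set ?U x"
      assume neg: "\<not> ?thesis"
      have "connected ((\<lambda>z. z \<bullet> a) ` ?T)"
        by (intro connected_continuous_image continuous_intros) auto
      moreover have "x \<in> ?T"
        using assms by (auto simp: connected_component_refl_eq)
      moreover have "y \<bullet> a \<le> 0 \<and> 0 \<le> x \<bullet> a \<or> x \<bullet> a \<le> 0 \<and> 0 \<le> y \<bullet> a"
        using neg by (auto simp: zero_less_mult_iff not_less)
      ultimately have "0 \<in> (\<lambda>z. z \<bullet> a) ` ?T"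
        using y unfolding connected_iff_interval by blast
      then show False
        using a connected_component_subset[of ?U x] by auto
    qed
    then show "y \<in> cell A x"
      by (simp add: cell_eq[OF assms])
  qed
qed

lemma regions_root_hyperplanes:
  "regions (root_hyperplanes A) = cell A ` {x. \<forall>a\<in>A. x \<bullet> a \<noteq> 0}"
proof -
  have "- \<Union>(root_hyperplanes A) = {y. \<forall>a\<in>A. y \<bullet> a \<noteq> 0}"
    by (auto simp: root_hyperplanes_def)
  then show ?thesis
    unfolding regions_def components_def
    by (auto simp: connected_component_hyperplanes intro!: image_cong)
qed

lemma closure_cell:
  assumes "\<forall>a\<in>A. x \<bullet> a \<noteq> 0"
  shows "closure (cell A x) = {y. \<forall>a\<in>A. 0 \<le> (y \<bullet> a) * (x \<bullet> a)}" (is "_ = ?R")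
proof
  have "closed (\<Inter>a\<in>A. {y. 0 \<le> (y \<bullet> a) * (x \<bullet> a)})"
    by (intro closed_INT ballI closed_Collect_le continuous_intros)
  also have "(\<Inter>a\<in>A. {y. 0 \<le> (y \<bullet> a) * (x \<bullet> a)}) = ?R"
    by auto
  finally show "closure (cell A x) \<subseteq> ?R"
    by (intro closure_minimal) (auto simp: cell_eq[OF assms] less_imp_le)
  show "?R \<subseteq> closure (cell A x)"
  proof
    fix y assume y: "y \<in> ?R"
    \<comment> \<open>Moving from \<open>y\<close> a vanishing distance in direction
      \<open>x\<close> adds \<open>e * (x \<bullet> a)\<^sup>2 > 0\<close> to each weak inequality
      and makes it strict.\<close>
    define g where "g m = y + inverse (real (Suc m)) *\<^sub>R x" for m
    have "g m \<in> cell A x" for m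
    proof -
      define e where "e = inverse (real (Suc m))"
      then have "e > 0" and g: "g m = y + e *\<^sub>R x"
        by (simp_all add: g_def)
      have "0 < (g m \<bullet> a) * (x \<bullet> a)" if "a \<in> A" for a
      proof -
        have "0 < (y \<bullet> a) * (x \<bullet> a) + e * (x \<bullet> a)\<^sup>2"
          using y that assms \<open>e > 0\<close> by (intro add_nonneg_pos) auto
        then show ?thesis
          by (simp add: g inner_add_left ring_distribs power2_eq_square ac_simps)
      qed
      then show ?thesis
        by (simp add: cell_eq[OF assms])
    qed
    moreover have "g \<longlonglongrightarrow> y + 0 *\<^sub>R x"
      unfolding g_def by (intro tendsto_intros LIMSEQ_inverse_real_of_nat)
    then have "g \<longlonglongrightarrow> y"
      by simp
    ultimately show "y \<in> closure (cell A x)"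
      unfolding closure_sequential by blast
  qed
qed

lemma open_cell:
  assumes "finite A" "\<forall>a\<in>A. x \<bullet> a \<noteq> 0"
  shows "open (cell A x)"
proof -
  have "open (\<Inter>a\<in>A. {y. 0 < (y \<bullet> a) * (x \<bullet> a)})"
    using assms(1) by (intro open_INT ballI open_Collect_less continuous_intros)
  also have "(\<Inter>a\<in>A. {y. 0 < (y \<bullet> a) * (x \<bullet> a)}) = cell A x"
    by (auto simp: cell_eq[OF assms(2)])
  finally show ?thesis .
qed

section \<open>The roots\<close>

text \<open>The roots of \<open>I\<^sub>2(n)\<close> are the unit vectors at the angles \<open>k \<pi> / n\<close>. The index is an integer,
  so that shifts of the index need no reduction modulo \<open>2 n\<close>.\<close>

definition planar_root :: "nat \<Rightarrow> int \<Rightarrow> real^2" where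
  "planar_root n k = vector [cos (k * pi / n), sin (k * pi / n)]"

lemma reflection_unit:
  assumes "norm a = 1"
  shows "reflection a x = x - (2 * (x \<bullet> a)) *\<^sub>R a"
  using assms by (simp add: reflection_def dot_square_norm)

lemma norm_vector_2: "norm (vector [x, y] :: real^2) = sqrt (x\<^sup>2 + y\<^sup>2)"
  by (simp add: norm_vec_def L2_set_def sum_2)

text \<open>The mirror of a root at angle s sends angle t to pi + 2s - t, and pi is n steps of
  pi/n.\<close>

lemma reflection_planar_root:
  assumes "n > 0"
  shows "reflection (planar_root n j) (planar_root n k) = planar_root n (int n + 2 * j - k)"
proof -
  define s t where "s = j * pi / n" and "t = k * pi / n"
  have angle: "(int n + 2 * j - k) * pi / n = pi + (2 * s - t)"
    using assms by (simp add: s_def t_def field_simps)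
  have c: "cos (2 * s - t) = 2 * cos (t - s) * cos s - cos t"
    and d: "sin (2 * s - t) = 2 * cos (t - s) * sin s - sin t"
  proof -
    define u where "u = t - s"
    have "t = s + u" "2 * s - t = s - u" "t - s = u"
      by (simp_all add: u_def)
    then show "cos (2 * s - t) = 2 * cos (t - s) * cos s - cos t"
      "sin (2 * s - t) = 2 * cos (t - s) * sin s - sin t"
      by (simp_all only: cos_add cos_diff sin_add sin_diff) simp_all
  qed
  have "cos (pi + (2 * s - t)) = - cos (2 * s - t)" "sin (pi + (2 * s - t)) = - sin (2 * s - t)"
    by (simp_all only: cos_add sin_add) auto
  moreover have "planar_root n k \<bullet> planar_root n j = cos (t - s)"
    by (simp add: planar_root_def inner_vec_def sum_2 cos_diff s_def t_def)
  moreover have "norm (planar_root n j) = 1"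
    by (simp add: planar_root_def norm_vector_2)
  ultimately show ?thesis
    unfolding reflection_unit[OF \<open>norm (planar_root n j) = 1\<close>]
    unfolding planar_root_def angle by (simp add: vec_eq_iff forall_2 c d flip: s_def t_def)
qed

lemma I2_simple_eq:
  assumes "n > 0"
  shows "I2_simple n = {planar_root n 0, planar_root n (int n - 1)}"
proof -
  have "(int n - 1) * pi / n = pi - pi / n"
    using assms by (simp add: field_simps)
  then have "planar_root n (int n - 1) = - cos (pi / n) *\<^sub>R axis 1 1 + sin (pi / n) *\<^sub>R axis 2 1"
    by (simp add: planar_root_def vec_eq_iff forall_2 axis_def)
  moreover have "planar_root n 0 = axis 1 1"
    by (simp add: planar_root_def vec_eq_iff forall_2 axis_def)
  ultimately show ?thesis
    by (simp add: I2_simple_def)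
qed

lemma root_system_superset: "A \<subseteq> root_system A"
proof
  fix a assume "a \<in> A"
  then have "a = id a \<and> id \<in> reflection_group A \<and> a \<in> A"
    by (simp add: reflection_group.id)
  then show "a \<in> root_system A"
    unfolding root_system_def by blast
qed

lemma root_system_reflection:
  assumes "a \<in> A" "r \<in> root_system A"
  shows "reflection a r \<in> root_system A"
proof -
  from assms(2) obtain w b where "w \<in> reflection_group A" "b \<in> A" "r = w b"
    by (auto simp: root_system_def)
  then have "reflection a r = (reflection a \<circ> w) b" "reflection a \<circ> w \<in> reflection_group A"
    using assms(1) by (auto intro: reflection_group.step)
  with \<open>b \<in> A\<close> show ?thesis
    unfolding root_system_def by blast
qed

lemma root_system_subset:
  assumes "A \<subseteq> R" "\<And>a r. a \<in> A \<Longrightarrow> r \<in> R \<Longrightarrow> reflection a r \<in> R"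
  shows "root_system A \<subseteq> R"
proof
  fix r assume "r \<in> root_system A"
  then obtain w a where "w \<in> reflection_group A" "a \<in> A" "r = w a"
    by (auto simp: root_system_def)
  then show "r \<in> R"
    using assms by (induction arbitrary: r rule: reflection_group.induct) auto
qed

text \<open>The simple reflections act on indices by k to n - k and k to 3n - 2 - k. Up to the
  period 2n, their two composites are the shifts by 2 and by -2.\<close>

lemma I2_eq:
  assumes "n > 0"
  shows "I2 n = range (planar_root n)"
proof
  note simple = I2_simple_eq[OF assms]
  note reflect = reflection_planar_root[OF assms]
  show "I2 n \<subseteq> range (planar_root n)"
    unfolding I2_def by (intro root_system_subset) (auto simp: simple reflect)
  define P where "P k \<longleftrightarrow> planar_root n k \<in> I2 n" for k
  have flip0: "P (int n - k)" if "P k" for k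
    using root_system_reflection[of "planar_root n 0" "I2_simple n" "planar_root n k"] that
    by (simp add: P_def I2_def simple reflect)
  have flip1: "P (3 * int n - 2 - k)" if "P k" for k
    using root_system_reflection[of "planar_root n (int n - 1)" "I2_simple n" "planar_root n k"] that
    by (simp add: P_def I2_def simple reflect algebra_simps)
  have period: "planar_root n (k + 2 * int n) = planar_root n k" for k
  proof -
    have "(k + 2 * int n) * pi / n = k * pi / n + 2 * pi"
      using assms by (simp add: field_simps)
    then show ?thesis
      by (simp add: planar_root_def)
  qed
  have down: "P (k - 2)" if "P k" for k
    using flip1[OF flip0[OF that]] period[of "k - 2"] by (simp add: P_def algebra_simps)
  have up: "P (k + 2)" if "P k" for k
    using flip0[OF flip1[OF that]] period[of "k + 2 - 2 * int n"] by (simp add: P_def algebra_simps)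
  have "P 0" "P (int n - 1)"
    using root_system_superset[of "I2_simple n"] by (auto simp: P_def I2_def simple)
  \<comment> \<open>The indices 0 and n - 1 have equal parity for odd n. Replacing 0 by its
    reflection n gives two consecutive indices, from which steps of 2 reach every integer.\<close>
  then have "P (int n)" "P (int n - 1)"
    using flip0[of 0] by simp_all
  then have all: "P (int n + k) \<and> P (int n - 1 + k)" for k
  proof (induction k rule: int_induct[where k = 0])
    case base
    then show ?case by simp
  next
    case (step1 i)
    then show ?case using up[of "int n - 1 + i"] by (simp add: algebra_simps)
  next
    case (step2 i)
    then show ?case using down[of "int n + i"] by (simp add: algebra_simps)
  qed
  have "P k" for k
    using all[of "k - int n"] by simp
  then show "range (planar_root n) \<subseteq> I2 n"
    by (auto simp: P_def)
qed

definition root3 :: "nat \<Rightarrow> int \<Rightarrow> real^3" where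
  "root3 n k = vector [cos (k * pi / n), sin (k * pi / n), 0]"

lemma A1_I2_eq:
  assumes "n > 0"
  shows "A1_I2 n = {axis 3 1, - axis 3 1} \<union> range (root3 n)"
proof -
  have "(\<lambda>v. vector [v $ 1, v $ 2, 0]) ` range (planar_root n) = range (root3 n)"
    by (simp add: image_image planar_root_def root3_def)
  then show ?thesis
    by (simp add: A1_I2_def I2_eq[OF assms])
qed

lemma inner_root3: "x \<bullet> root3 n k = x $ 1 * cos (k * pi / n) + x $ 2 * sin (k * pi / n)"
  by (simp add: root3_def inner_vec_def sum_3)

lemma axis_inner_root3: "axis 3 1 \<bullet> root3 n k = 0"
  by (simp add: inner_axis' root3_def)

text \<open>The angle is measured from the ray on which \<open>root3 n 0\<close> vanishes and enters the positive side.\<close>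

definition polar3 :: "real \<Rightarrow> real \<Rightarrow> real^3" where
  "polar3 t z = vector [sin t, - cos t, z]"

lemma polar3_inner_root3: "polar3 t z \<bullet> root3 n k = sin (t - k * pi / n)"
  by (simp add: inner_root3 polar3_def sin_diff)

lemma polar3_inner_axis: "polar3 t z \<bullet> axis 3 1 = z"
  by (simp add: inner_axis polar3_def)

lemma polar3_exists:
  fixes x :: "real^3"
  assumes "x $ 1 \<noteq> 0 \<or> x $ 2 \<noteq> 0"
  obtains r t where "r > 0" "\<And>n k. x \<bullet> root3 n k = r * sin (t - k * pi / n)"
proof -
  \<comment> \<open>A quarter turn, which matches the horizontal part (sin t, -cos t) of
    \<open>polar3\<close>.\<close>
  define w where "w = Complex (- x $ 2) (x $ 1)"
  have "w \<noteq> 0"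
    using assms by (auto simp: w_def complex_eq_iff)
  have "x $ 1 = cmod w * sin (Arg w)" "x $ 2 = - (cmod w * cos (Arg w))"
    using rcis_cmod_Arg[of w] by (auto simp: w_def rcis_def complex_eq_iff)
  then have "x \<bullet> root3 n k = cmod w * sin (Arg w - k * pi / n)" for n k
    by (simp add: inner_root3 sin_diff algebra_simps)
  with \<open>w \<noteq> 0\<close> show thesis
    by (intro that[of "cmod w" "Arg w"]) auto
qed

section \<open>Weyl chambers\<close>

text \<open>No multiple of n lies strictly between m and m + 1, so the sector from m pi/n to (m + 1)
  pi/n fits into one half-period of the sine. Its number \<open>m div int n\<close> decides the
  sign; \<open>u\<close> is the position inside it.\<close>

lemma sin_sector:
  fixes m :: int and t :: real
  assumes "n > 0"
  defines "u \<equiv> t - real_of_int (m div int n) * pi"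
  shows "sin t = (if even (m div int n) then 1 else - 1) * sin (u)"
    and "real_of_int m * pi / n \<le> t \<Longrightarrow> 0 \<le> u" and "real_of_int m * pi / n < t \<Longrightarrow> 0 < u"
    and "t \<le> (real_of_int m + 1) * pi / n \<Longrightarrow> u \<le> pi" and "t < (real_of_int m + 1) * pi / n \<Longrightarrow> u < pi"
proof -
  define q where "q = m div int n"
  define r where "r = m mod int n"
  have "m = q * int n + r" "0 \<le> r" "r < int n"
    using assms(1) by (simp_all add: q_def r_def)
  then have "q * int n \<le> m" "m + 1 \<le> (q + 1) * int n"
    by (simp_all add: algebra_simps)
  then have "real_of_int (q * int n) \<le> m" "real_of_int (m + 1) \<le> real_of_int ((q + 1) * int n)"
    by (simp_all only: of_int_le_iff)
  then have "real_of_int q * n * pi \<le> m * pi"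
    "(real_of_int m + 1) * pi \<le> (real_of_int q + 1) * n * pi"
    by (simp_all only: mult_le_cancel_right_pos[OF pi_gt_zero] of_int_mult of_int_add of_int_1
        of_int_of_nat_eq)
  then have bounds: "real_of_int q * pi \<le> m * pi / n" "(real_of_int m + 1) * pi / n \<le> (real_of_int q + 1) * pi"
    using assms(1) by (simp_all add: pos_le_divide_eq pos_divide_le_eq mult_ac)
  show "sin t = (if even (m div int n) then 1 else - 1) * sin (u)"
    unfolding u_def by (simp add: sin_diff mult.commute[of _ pi] sin_npi_int cos_npi_int)
  show "real_of_int m * pi / n \<le> t \<Longrightarrow> 0 \<le> u" "real_of_int m * pi / n < t \<Longrightarrow> 0 < u"
    "t \<le> (real_of_int m + 1) * pi / n \<Longrightarrow> u \<le> pi" "t < (real_of_int m + 1) * pi / n \<Longrightarrow> u < pi"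
    using bounds by (simp_all add: u_def distrib_right flip: q_def)
qed

lemma sgn_sin_sector:
  fixes m :: int and t :: real
  assumes "n > 0" "real_of_int m * pi / n < t" "t < (real_of_int m + 1) * pi / n"
  shows "sgn (sin t) = (if even (m div int n) then 1 else - 1)"
  unfolding sin_sector(1)[OF assms(1), of t m]
  using sin_gt_zero[OF sin_sector(3)[OF assms(1,2)] sin_sector(5)[OF assms(1,3)]]
  by (simp add: sgn_mult)

lemma sin_sector_weak:
  fixes m :: int and t :: real
  assumes "n > 0" "real_of_int m * pi / n \<le> t" "t \<le> (real_of_int m + 1) * pi / n"
  shows "0 \<le> (if even (m div int n) then 1 else - 1) * sin t"
  unfolding sin_sector(1)[OF assms(1), of t m]
  using sin_ge_zero[OF sin_sector(2)[OF assms(1,2)] sin_sector(4)[OF assms(1,3)]]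
  by simp

text \<open>The half-integer angle lies midway between two consecutive root planes, so one explicit
  point represents each sector.\<close>

definition chamber_point :: "nat \<Rightarrow> int \<Rightarrow> real \<Rightarrow> real^3" where
  "chamber_point n j s = polar3 ((j + 1/2) * pi / n) s"

lemma chamber_point_periodic:
  assumes "n > 0"
  shows "chamber_point n (j mod (2 * int n)) s = chamber_point n j s"
proof -
  have "real_of_int j = j mod (2 * int n) + 2 * n * (j div (2 * int n))"
  proof -
    have "j = j mod (2 * int n) + 2 * int n * (j div (2 * int n))"
      by simp
    then have "real_of_int j = real_of_int (j mod (2 * int n) + 2 * int n * (j div (2 * int n)))"
      by (rule arg_cong)
    then show ?thesis
      by (simp only: of_int_add of_int_mult of_int_numeral of_int_of_nat_eq)
  qed
  then have "(j + 1/2) * pi / n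
      = (j mod (2 * int n) + 1/2) * pi / n + 2 * pi * (j div (2 * int n))"
    using assms by (simp add: field_simps)
  then show ?thesis
    unfolding chamber_point_def polar3_def by (simp add: sin_add cos_add)
qed

lemma sgn_chamber_point:
  assumes "n > 0"
  shows "sgn (chamber_point n j s \<bullet> root3 n k) = (if even ((j - k) div int n) then 1 else - 1)"
  unfolding chamber_point_def polar3_inner_root3
proof (rule sgn_sin_sector[OF assms])
  have "(j + 1/2) * pi / n - k * pi / n = (j - k + 1/2) * pi / n"
    by (simp add: add_divide_distrib diff_divide_distrib distrib_right left_diff_distrib)
  then show "real_of_int (j - k) * pi / n < (j + 1/2) * pi / n - k * pi / n"
    "(j + 1/2) * pi / n - k * pi / n < (real_of_int (j - k) + 1) * pi / n"
    using assms by (simp_all add: divide_strict_right_mono)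
qed

lemma chamber_point_inner_axis: "chamber_point n j s \<bullet> axis 3 1 = s"
  by (simp add: chamber_point_def polar3_inner_axis)

lemma chamber_point_regular:
  assumes "n > 0" "s \<noteq> 0" "a \<in> A1_I2 n"
  shows "chamber_point n j s \<bullet> a \<noteq> 0"
proof -
  have "chamber_point n j s \<bullet> root3 n k \<noteq> 0" for k
    using sgn_chamber_point[OF assms(1), of j s k] by (auto split: if_splits)
  then show ?thesis
    using assms by (auto simp: A1_I2_eq chamber_point_inner_axis)
qed

lemma cell_A1_I2_eqI:
  assumes "n > 0" "\<And>k. sgn (x \<bullet> root3 n k) = sgn (y \<bullet> root3 n k)"
    "sgn (x \<bullet> axis 3 1) = sgn (y \<bullet> axis 3 1)"
  shows "cell (A1_I2 n) x = cell (A1_I2 n) y"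
  by (rule cell_cong) (use assms in \<open>auto simp: cell_def A1_I2_eq sgn_minus\<close>)

lemma regular_cell_eq_chamber_point:
  assumes "n > 0" "\<forall>a\<in>A1_I2 n. x \<bullet> a \<noteq> 0"
  obtains j s where "s \<in> {1, - 1}" "cell (A1_I2 n) x = cell (A1_I2 n) (chamber_point n j s)"
proof -
  have reg: "x \<bullet> root3 n k \<noteq> 0" "x \<bullet> axis 3 1 \<noteq> 0" for k
    using assms by (auto simp: A1_I2_eq)
  then have "x $ 1 \<noteq> 0 \<or> x $ 2 \<noteq> 0"
    using reg(1)[of 0] by (auto simp: inner_root3)
  then obtain r t where "r > 0" and x: "\<And>n k. x \<bullet> root3 n k = r * sin (t - k * pi / n)"
    using polar3_exists by blast
  \<comment> \<open>The sector containing \<open>t\<close>, in units of pi/n. The left end is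
    excluded below because root \<open>j\<close> would vanish there.\<close>
  define j where "j = \<lfloor>t * n / pi\<rfloor>"
  have "j \<le> t * n / pi" "t * n / pi < j + 1"
    unfolding j_def by linarith+
  then have j: "j * pi / n \<le> t" "t < (j + 1) * pi / n"
    using assms(1) by (simp_all add: field_simps)
  have "t \<noteq> j * pi / n"
    using x[of n j] reg(1)[of j] by auto
  with j have "j * pi / n < t"
    by simp
  have "sgn (x \<bullet> root3 n k) = (if even ((j - k) div int n) then 1 else - 1)" for k
  proof -
    have "sgn (sin (t - k * pi / n)) = (if even ((j - k) div int n) then 1 else - 1)"
      using assms(1) j \<open>j * pi / n < t\<close>
      by (intro sgn_sin_sector) (simp_all add: field_simps)
    with \<open>r > 0\<close> show ?thesis
      by (simp add: x sgn_mult)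
  qed
  moreover define s where "s = sgn (x \<bullet> axis 3 1)"
  ultimately have "cell (A1_I2 n) x = cell (A1_I2 n) (chamber_point n j s)"
    using assms(1) by (intro cell_A1_I2_eqI)
      (simp_all add: sgn_chamber_point chamber_point_inner_axis)
  moreover have "s \<in> {1, - 1}"
    using reg(2) by (auto simp: s_def sgn_if)
  ultimately show thesis
    by (rule that[rotated])
qed

text \<open>Some root separates two distinct sectors. If they are at most a half turn apart, root
  \<open>i'\<close> has quotients -1 and 0; otherwise root \<open>i\<close> has quotients 0 and
  1.\<close>

lemma even_div_differ:
  fixes N :: int
  assumes "i < i'" "i' < i + 2 * N"
  shows "\<exists>k. even ((i - k) div N) \<noteq> even ((i' - k) div N)"
proof (cases "i' - i \<le> N")
  case True
  have "(i - i') div N = - 1"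
    by (rule int_div_pos_eq[where r = "N + i - i'"]) (use assms True in auto)
  then show ?thesis
    by (intro exI[of _ i']) simp
next
  case False
  have "(i' - i) div N = 1"
    by (rule int_div_pos_eq[where r = "i' - i - N"]) (use assms False in auto)
  then show ?thesis
    by (intro exI[of _ i]) simp
qed

text \<open>The sectors are counted from sector \<open>j\<close> on, so that an arbitrary chamber becomes
  \<open>chamber n j (0, s)\<close>.\<close>

definition chamber :: "nat \<Rightarrow> int \<Rightarrow> int \<times> real \<Rightarrow> (real^3) set" where
  "chamber n j = (\<lambda>(i, s). cell (A1_I2 n) (chamber_point n (j + i) s))"

lemma weyl_chambers_A1_I2:
  assumes "n > 0"
  shows "weyl_chambers (A1_I2 n) = chamber n j ` ({0..<2 * int n} \<times> {1, - 1})"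
proof
  show "weyl_chambers (A1_I2 n) \<subseteq> chamber n j ` ({0..<2 * int n} \<times> {1, - 1})"
  proof
    fix D assume "D \<in> weyl_chambers (A1_I2 n)"
    then obtain x where "D = cell (A1_I2 n) x" "\<forall>a\<in>A1_I2 n. x \<bullet> a \<noteq> 0"
      by (auto simp: weyl_chambers_def regions_root_hyperplanes)
    then obtain k s where s: "s \<in> {1, - 1}" and D: "D = cell (A1_I2 n) (chamber_point n k s)"
      using regular_cell_eq_chamber_point[OF assms] by metis
    define i where "i = (k - j) mod (2 * int n)"
    have "chamber_point n (j + i) s = chamber_point n k s"
      using chamber_point_periodic[OF assms, of "j + i" s] chamber_point_periodic[OF assms, of k s]
      by (simp add: i_def mod_simps)
    then have "D = chamber n j (i, s)"
      by (simp add: D chamber_def)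
    moreover have "i \<in> {0..<2 * int n}"
      using assms by (simp add: i_def)
    ultimately show "D \<in> chamber n j ` ({0..<2 * int n} \<times> {1, - 1})"
      using s by blast
  qed
  show "chamber n j ` ({0..<2 * int n} \<times> {1, - 1}) \<subseteq> weyl_chambers (A1_I2 n)"
    using chamber_point_regular[OF assms]
    by (auto simp: chamber_def weyl_chambers_def regions_root_hyperplanes)
qed

lemma inj_on_chamber:
  assumes "n > 0"
  shows "inj_on (chamber n j) ({0..<2 * int n} \<times> {1, - 1})"
proof (rule inj_onI)
  fix p p' assume p: "p \<in> {0..<2 * int n} \<times> {1, - 1 :: real}"
    "p' \<in> {0..<2 * int n} \<times> {1, - 1 :: real}" and eq: "chamber n j p = chamber n j p'"
  obtain i s i' s' where [simp]: "p = (i, s)" "p' = (i', s')"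
    by fastforce
  have "chamber_point n (j + i) s \<in> cell (A1_I2 n) (chamber_point n (j + i') s')"
    using eq self_in_cell by (fastforce simp: chamber_def)
  then have sgn: "sgn (chamber_point n (j + i) s \<bullet> a) = sgn (chamber_point n (j + i') s' \<bullet> a)"
    if "a \<in> A1_I2 n" for a
    using that by (simp add: cell_def)
  have "sgn s = sgn s'"
    using sgn[of "axis 3 1"] by (simp add: A1_I2_eq[OF assms] chamber_point_inner_axis)
  then have "s = s'"
    using p by auto
  have same: "even ((j + i - k) div int n) = even ((j + i' - k) div int n)" for k
    using sgn[of "root3 n k"] assms
    by (simp add: A1_I2_eq sgn_chamber_point split: if_splits)
  have "i = i'"
  proof (rule ccontr)
    assume "i \<noteq> i'"
    then have "j + i < j + i' \<or> j + i' < j + i"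
      by auto
    then show False
      using even_div_differ[of "j + i" "j + i'" "int n"] even_div_differ[of "j + i'" "j + i" "int n"]
        same p by auto
  qed
  with \<open>s = s'\<close> show "p = p'"
    by simp
qed

section \<open>Walls of a chamber\<close>

lemma sin_pi_over_pos:
  assumes "n \<ge> 2"
  shows "0 < sin (pi / real n)"
proof (rule sin_gt_zero)
  show "pi / real n < pi"
    using assms by (simp add: divide_less_eq)
qed (use assms in simp)

text \<open>Both ends of one closed sector: two consecutive sines never have strictly opposite
  signs, and the sign is that of the sector.\<close>

lemma sin_lattice_sign:
  assumes "n > 0"
  shows "0 \<le> (if even (m div int n) then 1 else - 1) * sin (real_of_int m * pi / n)"
    and "0 \<le> (if even (m div int n) then 1 else - 1) * sin (real_of_int (m + 1) * pi / n)"
proof -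
  have "real_of_int m * pi / n \<le> (real_of_int m + 1) * pi / n"
    by (intro divide_right_mono mult_right_mono) simp_all
  then show "0 \<le> (if even (m div int n) then 1 else - 1) * sin (real_of_int m * pi / n)"
    "0 \<le> (if even (m div int n) then 1 else - 1) * sin (real_of_int (m + 1) * pi / n)"
    unfolding of_int_add of_int_1
    by (rule sin_sector_weak[OF assms order_refl], rule sin_sector_weak[OF assms _ order_refl])
qed

lemma shift_angle: "(real_of_int (j + 1)) * pi / n = j * pi / n + pi / n"
  by (simp add: distrib_right add_divide_distrib)

text \<open>Three unit vectors in a plane satisfy a linear relation whose coefficients are the sines
  of the angles between the other two.\<close>

lemma root3_relation:
  "sin (real_of_int (k - j) * pi / n) *\<^sub>R root3 n (j + 1)
    = sin (real_of_int (k - 1 - j) * pi / n) *\<^sub>R root3 n j + sin (pi / n) *\<^sub>R root3 n k"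
proof -
  define A D \<phi> where "A = real_of_int (k - 1 - j) * pi / n" and "D = pi / n"
    and "\<phi> = real_of_int (j + 1) * pi / n"
  have angles: "real_of_int (k - j) * pi / n = A + D" "j * pi / n = \<phi> - D" "k * pi / n = A + \<phi>"
    by (simp_all add: A_def D_def \<phi>_def left_diff_distrib distrib_right add_divide_distrib
        diff_divide_distrib)
  have "sin (A + D) * cos \<phi> = sin A * cos (\<phi> - D) + sin D * cos (A + \<phi>)"
    "sin (A + D) * sin \<phi> = sin A * sin (\<phi> - D) + sin D * sin (A + \<phi>)"
    by (simp_all add: sin_add cos_add sin_diff cos_diff algebra_simps)
  then show ?thesis
    unfolding root3_def angles A_def[symmetric] D_def[symmetric] \<phi>_def[symmetric]
    by (simp add: vec_eq_iff forall_3)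
qed

lemma polar3_root3:
  "polar3 (j * pi / n) z \<bullet> root3 n k = sin (real_of_int (j - k) * pi / n)"
  by (simp add: polar3_inner_root3 left_diff_distrib diff_divide_distrib)

text \<open>The two \<open>polar3\<close> vectors span the edges of sector \<open>j\<close> and are,
  up to scale, dual to the roots \<open>j + 1\<close> and \<open>j\<close>. By Cramer's rule each
  coefficient is therefore a multiple of the one root functional whose vanishing should kill
  it.\<close>

lemma wall_frame_decomposition:
  fixes x :: "real^3"
  assumes "n \<ge> 2"
  obtains \<alpha> \<beta> \<gamma> where "x = \<alpha> *\<^sub>R polar3 (real_of_int j * pi / n) 0
      + \<beta> *\<^sub>R polar3 (real_of_int (j + 1) * pi / n) 0 + \<gamma> *\<^sub>R axis 3 1"
    and "x \<bullet> root3 n (j + 1) = 0 \<longrightarrow> \<alpha> = 0" "x \<bullet> root3 n j = 0 \<longrightarrow> \<beta> = 0"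
      "x \<bullet> axis 3 1 = 0 \<longrightarrow> \<gamma> = 0"
proof -
  define b b' where "b = real_of_int j * pi / n" and "b' = real_of_int (j + 1) * pi / n"
  define d where "d = sin (b' - b)"
  have "b' - b = pi / n"
    unfolding b_def b'_def shift_angle by simp
  then have "d > 0"
    using sin_pi_over_pos[OF assms] by (simp add: d_def)
  define u v where "u = x \<bullet> root3 n j" and "v = x \<bullet> root3 n (j + 1)"
  have u: "u = x $ 1 * cos b + x $ 2 * sin b" and v: "v = x $ 1 * cos b' + x $ 2 * sin b'"
    by (simp_all only: u_def v_def inner_root3 b_def b'_def)
  have "d * x $ 1 = u * sin b' - v * sin b" "d * x $ 2 = v * cos b - u * cos b'"
    by (simp_all add: d_def u v sin_diff algebra_simps)
  with \<open>d > 0\<close> have "x $ 1 = (- v / d) * sin b + (u / d) * sin b'"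
    "x $ 2 = - ((- v / d) * cos b) - (u / d) * cos b'"
    by (simp_all add: divide_simps mult.commute)
  then have "x = (- v / d) *\<^sub>R polar3 b 0 + (u / d) *\<^sub>R polar3 b' 0 + (x $ 3) *\<^sub>R axis 3 1"
    by (simp only: vec_eq_iff forall_3) (simp add: polar3_def axis_def)
  then show thesis
    unfolding b_def b'_def by (rule that) (simp_all add: u_def v_def inner_axis)
qed

lemma root3_coordinates_surj:
  assumes "n \<ge> 2"
  obtains x where "x \<bullet> root3 n j = u" "x \<bullet> root3 n (j + 1) = v" "x \<bullet> axis 3 1 = w"
proof -
  define \<delta> where "\<delta> = sin (pi / n)"
  have "\<delta> > 0"
    using sin_pi_over_pos[OF assms] by (simp add: \<delta>_def)
  define P Q where "P = polar3 (real_of_int j * pi / n) 0"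
    and "Q = polar3 (real_of_int (j + 1) * pi / n) 0"
  have products: "P \<bullet> root3 n j = 0" "P \<bullet> root3 n (j + 1) = - \<delta>" "Q \<bullet> root3 n j = \<delta>"
    "Q \<bullet> root3 n (j + 1) = 0" "P \<bullet> axis 3 1 = 0" "Q \<bullet> axis 3 1 = 0"
    unfolding P_def Q_def polar3_root3 polar3_inner_axis by (simp_all add: \<delta>_def)
  define x where "x = (- v / \<delta>) *\<^sub>R P + (u / \<delta>) *\<^sub>R Q + w *\<^sub>R axis 3 1"
  have "x \<bullet> root3 n j = u" "x \<bullet> root3 n (j + 1) = v" "x \<bullet> axis 3 1 = w"
    unfolding x_def inner_add_left inner_scaleR_left products axis_inner_root3
    using \<open>\<delta> > 0\<close> by (simp_all add: inner_axis)
  then show thesis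
    by (rule that)
qed

text \<open>The section contains 0, so its affine hull is its span and the test for a wall becomes a
  spanning test.\<close>

lemma affine_hull_hyperplane_section:
  fixes S :: "'a::real_inner set"
  assumes "0 \<in> S" "{x. x \<bullet> a = 0} \<subseteq> span ({x. x \<bullet> a = 0} \<inter> S)"
  shows "affine hull ({x. x \<bullet> a = 0} \<inter> S) = {x. x \<bullet> a = 0}"
proof
  have sub: "subspace {x. x \<bullet> a = 0}"
    by (simp add: subspace_def inner_add_left)
  show "affine hull ({x. x \<bullet> a = 0} \<inter> S) \<subseteq> {x. x \<bullet> a = 0}"
    by (intro hull_minimal subspace_imp_affine sub) simp
  have "0 \<in> affine hull ({x. x \<bullet> a = 0} \<inter> S)"
    using assms(1) by (intro hull_inc) simp
  then show "{x. x \<bullet> a = 0} \<subseteq> affine hull ({x. x \<bullet> a = 0} \<inter> S)"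
    using assms(2) affine_hull_span_0 by metis
qed

lemma closure_chamber:
  assumes "n > 0" "s \<in> {1, - 1}"
  shows "closure (chamber n j (0, s)) = {y. \<forall>a\<in>A1_I2 n. 0 \<le> (y \<bullet> a) * (chamber_point n j s \<bullet> a)}"
proof -
  have "\<forall>a\<in>A1_I2 n. chamber_point n j s \<bullet> a \<noteq> 0"
    by (intro ballI chamber_point_regular[OF assms(1)]) (use assms(2) in auto)
  then show ?thesis
    by (simp add: chamber_def closure_cell)
qed

lemma mult_sgn_nonneg_iff:
  fixes r s :: real
  shows "0 \<le> r * sgn s \<longleftrightarrow> 0 \<le> r * s"
  by (auto simp: sgn_if zero_le_mult_iff)

lemma mem_closure_chamber_iff:
  assumes "n > 0" "s \<in> {1, - 1}"
  shows "y \<in> closure (chamber n j (0, s)) \<longleftrightarrow>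
    0 \<le> (y \<bullet> axis 3 1) * s \<and>
    (\<forall>k. 0 \<le> (if even ((j - k) div int n) then 1 else - 1) * (y \<bullet> root3 n k))"
proof -
  have "0 \<le> (y \<bullet> root3 n k) * (chamber_point n j s \<bullet> root3 n k) \<longleftrightarrow>
    0 \<le> (if even ((j - k) div int n) then 1 else - 1) * (y \<bullet> root3 n k)" for k
    by (subst mult_sgn_nonneg_iff[symmetric])
      (simp add: sgn_chamber_point[OF assms(1)] mult.commute)
  then show ?thesis
    by (auto simp: closure_chamber[OF assms] A1_I2_eq[OF assms(1)] chamber_point_inner_axis)
qed

text \<open>Normals of the three walls, with no orientation intended: on sector \<open>j\<close>,
  root \<open>j\<close> is positive and root \<open>j + 1\<close> negative.\<close>

definition basis3 :: "nat \<Rightarrow> int \<Rightarrow> (real^3) set" where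
  "basis3 n j = {root3 n j, root3 n (j + 1), axis 3 1}"

text \<open>\<open>P\<close>, \<open>Q\<close>, \<open>E\<close> lie on the edges of the closed
  chamber, and each of the three planes is spanned by two of them. Any other vertical root plane
  meets the closed chamber in too small a set.\<close>

lemma walls_chamber:
  assumes "n \<ge> 2" "s \<in> {1, - 1}"
  shows "walls (A1_I2 n) (chamber n j (0, s)) = root_hyperplanes (basis3 n j)"
proof -
  define K where "K = closure (chamber n j (0, s))"
  define P Q E where "P = polar3 (j * pi / n) 0" and "Q = polar3 (real_of_int (j + 1) * pi / n) 0"
    and "E = s *\<^sub>R (axis 3 1 :: real^3)"
  define \<delta> where "\<delta> = sin (pi / n)"
  have "\<delta> > 0" "n > 0"
    using sin_pi_over_pos[OF assms(1)] assms(1) by (simp_all add: \<delta>_def)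
  note K = mem_closure_chamber_iff[OF \<open>n > 0\<close> assms(2), where j = j, folded K_def]
  \<comment> \<open>This makes root \<open>j + 1\<close> nonpositive on the closed chamber.\<close>
  have div: "(- 1) div int n = - 1"
    using \<open>n > 0\<close> by (simp add: div_eq_minus1)
  have "j + 1 - k = j - k + 1" for k
    by simp
  then have weak: "0 \<le> (if even ((j - k) div int n) then 1 else - 1) * sin (real_of_int (j - k) * pi / n)"
    "0 \<le> (if even ((j - k) div int n) then 1 else - 1) * sin (real_of_int (j + 1 - k) * pi / n)" for k
    using sin_lattice_sign[OF \<open>n > 0\<close>, of "j - k"] by presburger+
  then have "P \<in> K" "Q \<in> K"
    unfolding K P_def Q_def polar3_root3 polar3_inner_axis by auto
  moreover have "E \<in> K" "0 \<in> K"
    using assms(2) by (auto simp: K E_def inner_axis axis_inner_root3)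
  ultimately have PQE: "P \<in> K" "Q \<in> K" "E \<in> K" "0 \<in> K"
    by auto
  have P: "P \<bullet> root3 n j = 0" "P \<bullet> axis 3 1 = 0" and Q: "Q \<bullet> root3 n (j + 1) = 0" "Q \<bullet> axis 3 1 = 0"
    and E: "E \<bullet> root3 n k = 0" for k
    by (simp_all add: P_def Q_def E_def polar3_inner_root3 polar3_inner_axis axis_inner_root3)
  have wall: "affine hull ({x. x \<bullet> a = 0} \<inter> K) = {x. x \<bullet> a = 0}" if a: "a \<in> basis3 n j" for a
  proof (rule affine_hull_hyperplane_section[OF \<open>0 \<in> K\<close>], rule subsetI)
    fix x assume "x \<in> {x. x \<bullet> a = 0}"
    then have x: "x \<bullet> a = 0" by simp
    have sub: "v \<in> span ({x. x \<bullet> a = 0} \<inter> K)" if "v \<in> K" "v \<bullet> a = 0" for v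
      using that by (intro span_base) simp
    obtain \<alpha> \<beta> \<gamma> where decomp: "x = \<alpha> *\<^sub>R P + \<beta> *\<^sub>R Q + \<gamma> *\<^sub>R axis 3 1"
      and zero: "x \<bullet> root3 n (j + 1) = 0 \<longrightarrow> \<alpha> = 0" "x \<bullet> root3 n j = 0 \<longrightarrow> \<beta> = 0"
        "x \<bullet> axis 3 1 = 0 \<longrightarrow> \<gamma> = 0"
      by (rule wall_frame_decomposition[OF assms(1), of x j, folded P_def Q_def])
    \<comment> \<open>For s = -1 the closure contains \<open>E\<close> but not the axis vector
      itself; the scalar \<open>s\<close> repairs the sign.\<close>
    have axis: "(axis 3 1 :: real^3) = s *\<^sub>R E"
      using assms(2) by (auto simp: E_def)
    consider "a = root3 n j" | "a = root3 n (j + 1)" | "a = axis 3 1"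
      using a by (auto simp: basis3_def)
    then show "x \<in> span ({x. x \<bullet> a = 0} \<inter> K)"
    proof cases
      case 1
      with x zero have "\<beta> = 0" by simp
      then show ?thesis
        unfolding decomp axis \<open>\<beta> = 0\<close> scaleR_zero_left add_0_left add_0_right
          by (intro span_add span_scale sub PQE; simp add: P E 1)
    next
      case 2
      with x zero have "\<alpha> = 0" by simp
      then show ?thesis
        unfolding decomp axis \<open>\<alpha> = 0\<close> scaleR_zero_left add_0_left add_0_right
          by (intro span_add span_scale sub PQE; simp add: Q E 2)
    next
      case 3
      with x zero have "\<gamma> = 0" by simp
      then show ?thesis
        unfolding decomp \<open>\<gamma> = 0\<close> scaleR_zero_left add_0_left add_0_right
          by (intro span_add span_scale sub PQE; simp add: P Q 3)
    qed
  qed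
  have no_other: "{x. x \<bullet> root3 n k = 0} \<in> root_hyperplanes (basis3 n j)"
    if hull: "affine hull ({x. x \<bullet> root3 n k = 0} \<inter> K) = {x. x \<bullet> root3 n k = 0}" for k
  proof -
    define u v where "u = sin (real_of_int (k - j) * pi / n)"
      and "v = sin (real_of_int (k - 1 - j) * pi / n)"
    have rel: "u *\<^sub>R root3 n (j + 1) = v *\<^sub>R root3 n j + \<delta> *\<^sub>R root3 n k"
      unfolding u_def v_def \<delta>_def by (rule root3_relation)
    then have rel': "u * (x \<bullet> root3 n (j + 1)) = v * (x \<bullet> root3 n j) + \<delta> * (x \<bullet> root3 n k)" for x
      by (metis inner_add_right inner_scaleR_right)
    \<comment> \<open>If one coefficient vanishes, root \<open>k\<close> is a multiple of root
      \<open>j\<close> or of root \<open>j + 1\<close> and defines the same plane.\<close>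
    show ?thesis
    proof (cases "u = 0 \<or> v = 0")
      case True
      have "u \<noteq> 0 \<or> v \<noteq> 0"
      proof (rule ccontr)
        assume "\<not> ?thesis"
        \<comment> \<open>The test vector is chosen so that root \<open>k\<close> takes the value
          sin(pi/2) = 1 on it.\<close>
        then have "\<delta> * (polar3 (k * pi / n + pi / 2) 0 \<bullet> root3 n k) = 0"
          using rel' by simp
        then show False
          using \<open>\<delta> > 0\<close> by (simp add: polar3_inner_root3)
      qed
      with True consider "u = 0" "v \<noteq> 0" | "v = 0" "u \<noteq> 0"
        by blast
      then show ?thesis
      proof cases
        case 1
        then have "\<delta> * (x \<bullet> root3 n k) = - v * (x \<bullet> root3 n j)" for x
          using rel'[of x] by simp
        then have "x \<bullet> root3 n k = 0 \<longleftrightarrow> x \<bullet> root3 n j = 0" for x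
          using 1 \<open>\<delta> > 0\<close> by (metis less_irrefl mult_eq_0_iff neg_equal_0_iff_equal)
        then show ?thesis
          by (auto simp: root_hyperplanes_def basis3_def)
      next
        case 2
        then have "\<delta> * (x \<bullet> root3 n k) = u * (x \<bullet> root3 n (j + 1))" for x
          using rel'[of x] by simp
        then have "x \<bullet> root3 n k = 0 \<longleftrightarrow> x \<bullet> root3 n (j + 1) = 0" for x
          using 2 \<open>\<delta> > 0\<close> by (metis less_irrefl mult_eq_0_iff)
        then show ?thesis
          by (auto simp: root_hyperplanes_def basis3_def)
      qed
    next
      \<comment> \<open>The closed sector meets the plane orthogonal to root \<open>k\<close> only in the vertical axis.\<close>
      case False
      have "0 \<le> u * v"
      proof -
        let ?e = "if even ((k - 1 - j) div int n) then 1 else - 1 :: real"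
        have "k - j = k - 1 - j + 1"
          by simp
        then have "0 \<le> ?e * u" "0 \<le> ?e * v"
          unfolding u_def v_def using sin_lattice_sign[OF \<open>n > 0\<close>, of "k - 1 - j"] by presburger+
        then show ?thesis
          by (auto simp: zero_le_mult_iff split: if_splits)
      qed
      with False have "0 < u * v"
        by (simp add: less_le)
      have "{x. x \<bullet> root3 n k = 0} \<inter> K \<subseteq> {x. x \<bullet> root3 n j = 0}"
      proof
        fix x assume x: "x \<in> {x. x \<bullet> root3 n k = 0} \<inter> K"
        then have "0 \<le> x \<bullet> root3 n j"
          using K[of x] by (auto dest: spec[of _ j])
        moreover have "x \<bullet> root3 n (j + 1) \<le> 0"
          using x K[of x] div by (auto dest: spec[of _ "j + 1"])
        \<comment> \<open>The relation at a zero of root \<open>k\<close>, multiplied by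
          \<open>v\<close>: the left side is at most 0 and the right side at least 0, so root
          \<open>j\<close> vanishes as well.\<close>
        moreover have "u * v * (x \<bullet> root3 n (j + 1)) = v\<^sup>2 * (x \<bullet> root3 n j)"
          using rel'[of x] x by (simp add: power2_eq_square)
        ultimately have "v\<^sup>2 * (x \<bullet> root3 n j) \<le> 0"
          using \<open>0 < u * v\<close> by (metis mult_nonneg_nonpos less_imp_le)
        with \<open>0 \<le> x \<bullet> root3 n j\<close> False show "x \<in> {x. x \<bullet> root3 n j = 0}"
          by (simp add: mult_le_0_iff)
      qed
      moreover have "affine {x. x \<bullet> root3 n j = 0}"
        using affine_hyperplane[of "root3 n j" 0] by (simp add: inner_commute)
      ultimately have "{x. x \<bullet> root3 n k = 0} \<subseteq> {x. x \<bullet> root3 n j = 0}"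
        using hull by (metis hull_minimal)
      \<comment> \<open>A point of plane \<open>k\<close> at which root \<open>j\<close> takes the
        nonzero value \<open>u\<close>; it contradicts the inclusion of plane \<open>k\<close> in
        plane \<open>j\<close>.\<close>
      moreover have "polar3 (k * pi / n) 0 \<bullet> root3 n k = 0"
        by (simp add: polar3_inner_root3)
      ultimately have "polar3 (k * pi / n) 0 \<bullet> root3 n j = 0"
        by blast
      with False show ?thesis
        by (simp add: polar3_root3 u_def)
    qed
  qed
  show ?thesis
  proof (intro equalityI subsetI)
    fix H assume "H \<in> walls (A1_I2 n) (chamber n j (0, s))"
    then obtain a where a: "a \<in> A1_I2 n" "H = {x. x \<bullet> a = 0}" "affine hull (H \<inter> K) = H"
      unfolding walls_def root_hyperplanes_def K_def by blast
    from a(1) consider "a = axis 3 1 \<or> a = - axis 3 1" | k where "a = root3 n k"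
      by (auto simp: A1_I2_eq[OF \<open>n > 0\<close>])
    then show "H \<in> root_hyperplanes (basis3 n j)"
    proof cases
      case 1
      then have "H = {x. x \<bullet> axis 3 1 = 0}"
        using a(2) by auto
      then show ?thesis
        unfolding root_hyperplanes_def basis3_def by blast
    next
      case 2
      with a(2,3) show ?thesis
        using no_other by blast
    qed
  next
    fix H assume "H \<in> root_hyperplanes (basis3 n j)"
    then obtain a where a: "a \<in> basis3 n j" "H = {x. x \<bullet> a = 0}"
      unfolding root_hyperplanes_def by blast
    moreover have "a \<in> A1_I2 n"
      using a(1) by (auto simp: basis3_def A1_I2_eq[OF \<open>n > 0\<close>])
    ultimately show "H \<in> walls (A1_I2 n) (chamber n j (0, s))"
      using wall[OF a(1)] unfolding walls_def root_hyperplanes_def K_def by blast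
  qed
qed

section \<open>The cones cut out by the walls\<close>

text \<open>With signs as booleans, the cones are indexed by a type with exactly 8 elements, and the
  antipodal map negates the index.\<close>

definition side :: "bool \<Rightarrow> real \<Rightarrow> bool" where
  "side p r \<longleftrightarrow> (if p then 0 < r else r < 0)"

lemma side_iff_sgn: "side p r \<longleftrightarrow> sgn r = (if p then 1 else - 1)"
  by (simp add: side_def sgn_1_pos sgn_1_neg)

lemma side_uminus: "side p (- r) \<longleftrightarrow> side (\<not> p) r"
  by (simp add: side_def)

lemma side_unique: "side p r \<Longrightarrow> side q r \<Longrightarrow> p = q"
  by (auto simp: side_def split: if_splits)

definition octant :: "nat \<Rightarrow> int \<Rightarrow> bool \<times> bool \<times> bool \<Rightarrow> (real^3) set" where
  "octant n j = (\<lambda>(p, q, r).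
    {x. side p (x \<bullet> root3 n j) \<and> side q (x \<bullet> root3 n (j + 1)) \<and> side r (x \<bullet> axis 3 1)})"

lemma mem_octant_iff: "x \<in> octant n j (p, q, r) \<longleftrightarrow>
    side p (x \<bullet> root3 n j) \<and> side q (x \<bullet> root3 n (j + 1)) \<and> side r (x \<bullet> axis 3 1)"
  by (simp add: octant_def)

lemma octant_eq_cell:
  assumes "x \<in> octant n j t"
  shows "octant n j t = cell (basis3 n j) x" and "\<forall>a\<in>basis3 n j. x \<bullet> a \<noteq> 0"
proof -
  obtain p q r where t: "t = (p, q, r)"
    by (cases t) auto
  from assms show "\<forall>a\<in>basis3 n j. x \<bullet> a \<noteq> 0"
    by (auto simp: t mem_octant_iff basis3_def side_def split: if_splits)
  from assms show "octant n j t = cell (basis3 n j) x"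
    by (simp add: octant_def t cell_def basis3_def side_iff_sgn)
qed

lemma octant_nonempty:
  assumes "n \<ge> 2"
  obtains x where "x \<in> octant n j t"
proof -
  obtain p q r where t: "t = (p, q, r)"
    by (cases t) auto
  define sg where "sg b = (if b then 1 else - 1 :: real)" for b
  have "side b (sg b)" for b
    by (simp add: sg_def side_def)
  with root3_coordinates_surj[OF assms, of j "sg p" "sg q" "sg r"] show thesis
    using that by (metis mem_octant_iff t)
qed

lemma octant_disjoint: "x \<in> octant n j t \<Longrightarrow> x \<in> octant n j t' \<Longrightarrow> t = t'"
  by (cases t; cases t') (auto simp: mem_octant_iff dest: side_unique)

lemma inj_octant:
  assumes "n \<ge> 2"
  shows "inj (octant n j)"
  by (metis assms injI octant_disjoint octant_nonempty)

definition opposite :: "bool \<times> bool \<times> bool \<Rightarrow> bool \<times> bool \<times> bool" where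
  "opposite = (\<lambda>(p, q, r). (\<not> p, \<not> q, \<not> r))"

lemma fst_opposite: "fst (opposite t) \<longleftrightarrow> \<not> fst t"
  by (cases t) (simp add: opposite_def)

lemma opposite_opposite: "opposite (opposite t) = t"
  by (cases t) (simp add: opposite_def)

lemma uminus_octant: "uminus ` octant n j t = octant n j (opposite t)"
proof -
  have "x \<in> uminus ` octant n j t \<longleftrightarrow> - x \<in> octant n j t" for x
    by (metis image_iff minus_minus)
  then show ?thesis
    by (cases t) (auto simp: opposite_def mem_octant_iff side_uminus)
qed

lemma regions_basis3:
  assumes "n \<ge> 2"
  shows "regions (root_hyperplanes (basis3 n j)) = range (octant n j)"
  unfolding regions_root_hyperplanes
proof (intro equalityI subsetI)
  fix K assume "K \<in> cell (basis3 n j) ` {x. \<forall>a\<in>basis3 n j. x \<bullet> a \<noteq> 0}"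
  then obtain x where x: "K = cell (basis3 n j) x" "\<forall>a\<in>basis3 n j. x \<bullet> a \<noteq> 0"
    by blast
  then have "x \<in> octant n j (0 < x \<bullet> root3 n j, 0 < x \<bullet> root3 n (j + 1), 0 < x \<bullet> axis 3 1)"
    by (auto simp: mem_octant_iff side_def basis3_def)
  with x(1) show "K \<in> range (octant n j)"
    using octant_eq_cell(1) by blast
next
  fix K assume "K \<in> range (octant n j)"
  then obtain t x where "K = octant n j t" "x \<in> octant n j t"
    using octant_nonempty[OF assms] by blast
  then show "K \<in> cell (basis3 n j) ` {x. \<forall>a\<in>basis3 n j. x \<bullet> a \<noteq> 0}"
    using octant_eq_cell by blast
qed

lemma card_hyperplanes_basis3:
  assumes "n \<ge> 2"
  shows "card (root_hyperplanes (basis3 n j)) = 3"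
proof -
  \<comment> \<open>Of the three planes, \<open>x\<close> lies only on the first and
    \<open>y\<close> only on the second; this separates all pairs.\<close>
  obtain x y where "x \<bullet> root3 n j = 0" "x \<bullet> root3 n (j + 1) = 1" "x \<bullet> axis 3 1 = 1"
    "y \<bullet> root3 n j = 1" "y \<bullet> root3 n (j + 1) = 0" "y \<bullet> axis 3 1 = 1"
    using root3_coordinates_surj[OF assms] by metis
  then have "{x. x \<bullet> root3 n j = 0} \<noteq> {x. x \<bullet> root3 n (j + 1) = 0}"
    "{x. x \<bullet> root3 n j = 0} \<noteq> {x. x \<bullet> axis 3 1 = 0}"
    "{x. x \<bullet> root3 n (j + 1) = 0} \<noteq> {x. x \<bullet> axis 3 1 = 0}"
    by (metis (mono_tags, lifting) mem_Collect_eq zero_neq_one)+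
  then show ?thesis
    by (simp add: root_hyperplanes_def basis3_def)
qed

text \<open>The wall normals are roots, so their signs are constant on a chamber and one sample
  point decides.\<close>

lemma chamber_subset_octant_iff:
  assumes "n > 0"
  shows "chamber n j (i, s) \<subseteq> octant n j t \<longleftrightarrow> chamber_point n (j + i) s \<in> octant n j t"
proof
  show "chamber_point n (j + i) s \<in> octant n j t" if "chamber n j (i, s) \<subseteq> octant n j t"
    using that self_in_cell by (fastforce simp: chamber_def)
  assume mem: "chamber_point n (j + i) s \<in> octant n j t"
  have "basis3 n j \<subseteq> A1_I2 n"
    by (auto simp: basis3_def A1_I2_eq[OF assms])
  then have "chamber n j (i, s) \<subseteq> cell (basis3 n j) (chamber_point n (j + i) s)"
    by (auto simp: chamber_def cell_def)
  with octant_eq_cell(1)[OF mem] show "chamber n j (i, s) \<subseteq> octant n j t"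
    by simp
qed

text \<open>The two windows of positivity over a full turn: offsets 0 to N - 1 for root
  \<open>j\<close>, offsets 1 to N for root \<open>j + 1\<close>.\<close>

lemma even_div_iff:
  fixes i N :: int
  assumes "0 \<le> i" "i < 2 * N"
  shows "even (i div N) \<longleftrightarrow> i < N" and "even ((i - 1) div N) \<longleftrightarrow> 1 \<le> i \<and> i \<le> N"
proof -
  have low: "k div N = 0" if "0 \<le> k" "k < N" for k
    using that by (simp add: div_pos_pos_trivial)
  have high: "k div N = 1" if "N \<le> k" "k < 2 * N" for k
    by (rule int_div_pos_eq[where r = "k - N"]) (use that in auto)
  have neg: "(- 1) div N = - 1"
    using assms by (simp add: div_eq_minus1)
  show "even (i div N) \<longleftrightarrow> i < N"
    using low[of i] high[of i] assms by (cases "i < N") auto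
  consider "i = 0" | "1 \<le> i" "i \<le> N" | "N < i"
    using assms by linarith
  then show "even ((i - 1) div N) \<longleftrightarrow> 1 \<le> i \<and> i \<le> N"
  proof cases
    case 1
    then show ?thesis using neg by simp
  next
    case 2
    then show ?thesis using low[of "i - 1"] by simp
  next
    case 3
    then show ?thesis using high[of "i - 1"] assms by simp
  qed
qed

text \<open>\<open>r\<close> fixes the half-space, so only sectors are counted. The windows share 1
  to n - 1 and both miss n + 1 to 2n - 1; only offset 0, the sector of the given chamber, and its
  opposite n lie in exactly one window.\<close>

lemma num_chambers_octant:
  assumes "n \<ge> 2"
  shows "num_chambers (A1_I2 n) (octant n j (p, q, r)) = (if p = q then n - 1 else 1)"
proof -
  have "n > 0"
    using assms by simp
  define I where "I = {0..<2 * int n} \<times> {1, - 1 :: real}"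
  define J where "J = {i \<in> {0..<2 * int n}. (i < int n) = p \<and> (1 \<le> i \<and> i \<le> int n) = q}"
  have iff: "chamber n j (i, s) \<subseteq> octant n j (p, q, r) \<longleftrightarrow> i \<in> J \<and> s = (if r then 1 else - 1)"
    if "(i, s) \<in> I" for i s
  proof -
    have "0 \<le> i" "i < 2 * int n" "s \<in> {1, - 1}"
      using that by (auto simp: I_def)
    moreover have "j + i - (j + 1) = i - 1"
      by simp
    ultimately show ?thesis
      unfolding chamber_subset_octant_iff[OF \<open>n > 0\<close>] mem_octant_iff side_iff_sgn
        sgn_chamber_point[OF \<open>n > 0\<close>] chamber_point_inner_axis
      by (auto simp: J_def even_div_iff)
  qed
  have "{t \<in> I. chamber n j t \<subseteq> octant n j (p, q, r)} = J \<times> {if r then 1 else - 1}"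
  proof (rule set_eqI)
    fix t :: "int \<times> real"
    obtain i s where t: "t = (i, s)"
      by fastforce
    have "J \<times> {if r then 1 else - 1} \<subseteq> I"
      by (auto simp: I_def J_def)
    then show "t \<in> {t \<in> I. chamber n j t \<subseteq> octant n j (p, q, r)} \<longleftrightarrow> t \<in> J \<times> {if r then 1 else - 1}"
      using iff[of i s] unfolding t by blast
  qed
  moreover have "{D \<in> weyl_chambers (A1_I2 n). D \<subseteq> octant n j (p, q, r)}
      = chamber n j ` {t \<in> I. chamber n j t \<subseteq> octant n j (p, q, r)}"
    unfolding weyl_chambers_A1_I2[OF \<open>n > 0\<close>, of j] I_def by blast
  moreover have "inj_on (chamber n j) {t \<in> I. chamber n j t \<subseteq> octant n j (p, q, r)}"
    by (rule inj_on_subset[OF inj_on_chamber[OF \<open>n > 0\<close>]]) (auto simp: I_def)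
  ultimately have "num_chambers (A1_I2 n) (octant n j (p, q, r)) = card J"
    by (simp add: num_chambers_def card_image card_cartesian_product)
  also have "J = (if p then if q then {1..<int n} else {0} else if q then {int n} else {int n + 1..<2 * int n})"
    using assms by (auto simp: J_def)
  also have "card \<dots> = (if p = q then n - 1 else 1)"
    using assms by (auto simp: nat_diff_distrib)
  finally show ?thesis .
qed

lemma weyl_chamber_eq_chamber:
  assumes "n > 0" "C \<in> weyl_chambers (A1_I2 n)"
  obtains j s where "s \<in> {1, - 1}" "C = chamber n j (0, s)"
proof -
  obtain x where C: "C = cell (A1_I2 n) x" and x: "\<forall>a\<in>A1_I2 n. x \<bullet> a \<noteq> 0"
    using assms(2) by (auto simp: weyl_chambers_def regions_root_hyperplanes)
  obtain j s where "s \<in> {1, - 1}" "cell (A1_I2 n) x = cell (A1_I2 n) (chamber_point n j s)"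
    using regular_cell_eq_chamber_point[OF assms(1) x] by metis
  then show thesis
    using that[of s j] by (simp add: C chamber_def)
qed

section \<open>Antipodal pairs of cones and choices of representatives\<close>

lemma octant_cone: "x \<in> octant n j t \<Longrightarrow> c > 0 \<Longrightarrow> c *\<^sub>R x \<in> octant n j t"
  by (cases t) (auto simp: mem_octant_iff side_def zero_less_mult_iff mult_less_0_iff)

lemma open_octant:
  assumes "n \<ge> 2"
  shows "open (octant n j t)"
proof -
  obtain x where "x \<in> octant n j t"
    using octant_nonempty[OF assms] by blast
  moreover have "finite (basis3 n j)"
    by (simp add: basis3_def)
  ultimately show ?thesis
    using octant_eq_cell open_cell by metis
qed

text \<open>Reduces an arbitrary choice from the pairs {x, f x} to one convenient choice
  \<open>R\<close>, since \<open>g\<close> agrees on each pair.\<close>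

lemma image_mset_transversal:
  assumes "finite R" "R \<inter> f ` R = {}" "inj_on f R" "\<And>x. x \<in> R \<Longrightarrow> g (f x) = g x"
    and S: "S \<subseteq> R \<union> f ` R" "\<And>x. x \<in> R \<Longrightarrow> x \<in> S \<longleftrightarrow> f x \<notin> S"
  shows "image_mset g (mset_set S) = image_mset g (mset_set R)"
proof -
  \<comment> \<open>The member of the pair of \<open>x\<close> that lies in \<open>S\<close>.\<close>
  define h where "h x = (if x \<in> S then x else f x)" for x
  have "S = h ` R"
    using S by (auto simp: h_def)
  moreover have "inj_on h R"
    using assms(2,3) by (auto simp: inj_on_def h_def)
  ultimately have "mset_set S = image_mset h (mset_set R)"
    by (simp add: image_mset_mset_set)
  then have "image_mset g (mset_set S) = image_mset (g \<circ> h) (mset_set R)"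
    by (simp add: multiset.map_comp)
  also have "\<dots> = image_mset g (mset_set R)"
    using assms(1,4) by (intro image_mset_cong) (auto simp: h_def)
  finally show ?thesis .
qed

lemma num_chambers_opposite:
  assumes "n \<ge> 2"
  shows "num_chambers (A1_I2 n) (octant n j (opposite t)) = num_chambers (A1_I2 n) (octant n j t)"
  by (cases t) (simp add: opposite_def num_chambers_octant[OF assms])

lemma octant_transversals:
  assumes "n \<ge> 2" "S \<subseteq> range (octant n j)" "\<forall>K\<in>range (octant n j). K \<in> S \<longleftrightarrow> uminus ` K \<notin> S"
  shows "image_mset (num_chambers (A1_I2 n)) (mset_set S) = {#1, 1, n - 1, n - 1#}"
proof -
  note inj = inj_octant[OF assms(1), of j]
  \<comment> \<open>The triples with first entry true; \<open>opposite\<close> flips that entry, so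
    \<open>R\<close> meets each pair once.\<close>
  define R where "R = {(True, True, True), (True, True, False), (True, False, True), (True, False, False)}"
  have R: "t \<in> R \<longleftrightarrow> fst t" for t
    by (cases t) (auto simp: R_def)
  have "image_mset (num_chambers (A1_I2 n)) (mset_set S)
      = image_mset (num_chambers (A1_I2 n)) (mset_set (octant n j ` R))"
  proof (rule image_mset_transversal[where f = "image uminus"])
    show "octant n j ` R \<inter> (`) uminus ` octant n j ` R = {}"
    proof -
      have "octant n j t \<noteq> uminus ` octant n j t'" if "t \<in> R" "t' \<in> R" for t t'
        using that unfolding uminus_octant inj_eq[OF inj] R by (metis fst_opposite)
      then show ?thesis
        by blast
    qed
    show "inj_on ((`) uminus) (octant n j ` R)"
      by (intro inj_onI) (simp add: inj_image_eq_iff)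
    show "num_chambers (A1_I2 n) (uminus ` K) = num_chambers (A1_I2 n) K" if "K \<in> octant n j ` R" for K
      using that by (auto simp: uminus_octant num_chambers_opposite[OF assms(1)])
    have "octant n j t \<in> octant n j ` R \<union> (`) uminus ` octant n j ` R" for t
    proof (cases "t \<in> R")
      case False
      then have "opposite t \<in> R"
        by (simp add: R fst_opposite)
      moreover have "octant n j t = uminus ` octant n j (opposite t)"
        by (simp add: uminus_octant opposite_opposite)
      ultimately show ?thesis
        by blast
    qed simp
    then have "range (octant n j) \<subseteq> octant n j ` R \<union> (`) uminus ` octant n j ` R"
      by (rule image_subsetI)
    with assms(2) show "S \<subseteq> octant n j ` R \<union> (`) uminus ` octant n j ` R"
      by (rule subset_trans)
    show "K \<in> S \<longleftrightarrow> uminus ` K \<notin> S" if "K \<in> octant n j ` R" for K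
      using assms(3) that by blast
  qed (simp add: R_def)
  also have "mset_set (octant n j ` R) = image_mset (octant n j) (mset_set R)"
    by (rule image_mset_mset_set[symmetric], rule inj_on_subset[OF inj]) simp
  also have "mset_set R = {#(True, True, True), (True, True, False), (True, False, True), (True, False, False)#}"
    by (simp add: R_def)
  also have "image_mset (num_chambers (A1_I2 n)) (image_mset (octant n j) \<dots>) = {#1, 1, n - 1, n - 1#}"
    by (simp add: num_chambers_octant[OF assms(1)])
  finally show ?thesis .
qed

text \<open>The orbits of a fixed-point-free involution partition \<open>A\<close> into two-element
  sets.\<close>

lemma card_involution_pairs:
  assumes "finite A" "\<And>x. x \<in> A \<Longrightarrow> f x \<in> A \<and> f x \<noteq> x \<and> f (f x) = x"
  shows "2 * card {{x, f x} |x. x \<in> A} = card A"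
proof -
  let ?P = "{{x, f x} |x. x \<in> A}"
  have "\<Union>?P = A"
    using assms(2) by blast
  moreover have "finite ?P"
    using assms(1) by simp
  moreover have "card c = 2" if "c \<in> ?P" for c
    using that assms(2) by (force simp: card_2_iff)
  moreover have "c \<inter> c' = {}" if pairs: "c \<in> ?P" "c' \<in> ?P" "c \<noteq> c'" for c c'
  proof -
    obtain x y where c: "x \<in> A" "y \<in> A" "c = {x, f x}" "c' = {y, f y}"
      using pairs(1,2) by blast
    show ?thesis
    proof (rule ccontr)
      assume "c \<inter> c' \<noteq> {}"
      then have "x = y \<or> x = f y \<or> f x = y \<or> f x = f y"
        using c by auto
      then have "x = y \<or> x = f y"
        using c assms(2) by metis
      then have "c = c'"
        using c assms(2)[of y] by auto
      with pairs(3) show False ..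
    qed
  qed
  ultimately show ?thesis
    using card_partition[of ?P 2] assms(1) by auto
qed

section \<open>Order of the reflection group\<close>

text \<open>The plane of \<open>I\<^sub>2(n)\<close> is identified with the complex numbers: reflections become
  \<open>z \<mapsto> - cis (2 \<theta>) * cnj z\<close> and rotations become \<open>z \<mapsto> cis \<theta> * z\<close>.\<close>

definition complex_part :: "real^3 \<Rightarrow> complex" where
  "complex_part x = Complex (x $ 1) (x $ 2)"

definition of_complex_part :: "complex \<Rightarrow> real \<Rightarrow> real^3" where
  "of_complex_part z r = vector [Re z, Im z, r]"

lemma complex_part_of_complex_part [simp]: "complex_part (of_complex_part z r) = z"
  "of_complex_part z r $ 3 = r"
  by (simp_all add: complex_part_def of_complex_part_def)

lemma of_complex_part_complex_part [simp]: "of_complex_part (complex_part x) (x $ 3) = x"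
  by (simp add: complex_part_def of_complex_part_def vec_eq_iff forall_3)

definition root_of_unity :: "nat \<Rightarrow> int \<Rightarrow> complex" where
  "root_of_unity n k = cis (2 * pi * real_of_int k / n)"

lemma root_of_unity_add: "root_of_unity n (k + l) = root_of_unity n k * root_of_unity n l"
  by (simp add: root_of_unity_def cis_mult distrib_left add_divide_distrib)

lemma root_of_unity_diff: "root_of_unity n (k - l) = root_of_unity n k * cnj (root_of_unity n l)"
  by (simp add: root_of_unity_def cis_mult cis_cnj right_diff_distrib diff_divide_distrib)

lemma root_of_unity_nonzero [simp]: "root_of_unity n k \<noteq> 0"
  by (simp add: root_of_unity_def)

lemma root_of_unity_eq_1_iff:
  assumes "n > 0"
  shows "root_of_unity n k = 1 \<longleftrightarrow> int n dvd k"
proof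
  assume "root_of_unity n k = 1"
  then have "cos (2 * pi * real_of_int k / n) = 1"
    by (simp add: root_of_unity_def complex_eq_iff)
  then obtain m where "2 * pi * real_of_int k / n = of_int m * 2 * pi"
    unfolding cos_one_2pi_int by blast
  then have "real_of_int k = real_of_int (int n * m)"
    using assms by (simp add: field_simps)
  then show "int n dvd k"
    by (metis dvd_triv_left of_int_eq_iff)
next
  assume "int n dvd k"
  then obtain m where "k = int n * m"
    by blast
  then have "2 * pi * real_of_int k / n = 2 * pi * real_of_int m"
    using assms by simp
  then show "root_of_unity n k = 1"
    by (simp add: root_of_unity_def cis_multiple_2pi)
qed

lemma root_of_unity_eq_iff:
  assumes "n > 0"
  shows "root_of_unity n k = root_of_unity n l \<longleftrightarrow> k mod int n = l mod int n"
proof -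
  have "root_of_unity n k = root_of_unity n (k - l) * root_of_unity n l"
    by (simp flip: root_of_unity_add)
  then have "root_of_unity n k = root_of_unity n l \<longleftrightarrow> root_of_unity n (k - l) = 1"
    by simp
  then show ?thesis
    by (simp add: root_of_unity_eq_1_iff[OF assms] mod_eq_dvd_iff)
qed

text \<open>Normal form of a group element: \<open>b\<close> tells rotation from reflection in the
  plane, \<open>s\<close> is the sign on the axis. The minus sign makes \<open>(False, k, 1)\<close>
  the reflection in root \<open>k\<close>, and an integer \<open>k\<close> lets composition add or
  subtract indices.\<close>

definition dihedral_map :: "nat \<Rightarrow> bool \<times> int \<times> real \<Rightarrow> real^3 \<Rightarrow> real^3" where
  "dihedral_map n = (\<lambda>(b, k, s) x. of_complex_part
    (if b then root_of_unity n k * complex_part x else - root_of_unity n k * cnj (complex_part x))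
    (s * x $ 3))"

lemma dihedral_map_cong:
  assumes "n > 0"
  shows "dihedral_map n (b, k mod int n, s) = dihedral_map n (b, k, s)"
proof -
  have "root_of_unity n (k mod int n) = root_of_unity n k"
    by (simp add: root_of_unity_eq_iff[OF assms])
  then show ?thesis
    by (simp add: dihedral_map_def cong: if_cong)
qed

lemma reflection_root3: "reflection (root3 n k) = dihedral_map n (False, k, 1)"
proof
  fix x
  define t where "t = k * pi / n"
  have r: "root3 n k = vector [cos t, sin t, 0]" and "2 * pi * k / n = 2 * t"
    by (simp_all add: root3_def t_def)
  have "root3 n k \<bullet> root3 n k = 1"
    using sin_cos_squared_add[of t] by (simp add: r inner_vec_def sum_3 power2_eq_square)
  then have "reflection (root3 n k) x = x - (2 * (x \<bullet> root3 n k)) *\<^sub>R root3 n k"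
    by (simp add: reflection_def)
  also have "\<dots> = x - (2 * (x $ 1 * cos t + x $ 2 * sin t)) *\<^sub>R vector [cos t, sin t, 0]"
    unfolding inner_root3 by (simp only: r t_def)
  finally have "reflection (root3 n k) x
      = x - (2 * (x $ 1 * cos t + x $ 2 * sin t)) *\<^sub>R vector [cos t, sin t, 0]" .
  moreover have "x $ 1 - 2 * (x $ 1 * cos t + x $ 2 * sin t) * cos t
      = - (cos (2 * t) * x $ 1 + sin (2 * t) * x $ 2)"
    unfolding cos_double_cos sin_double by (simp add: algebra_simps power2_eq_square)
  moreover have "x $ 2 - 2 * (x $ 1 * cos t + x $ 2 * sin t) * sin t
      = - (sin (2 * t) * x $ 1 - cos (2 * t) * x $ 2)"
    unfolding cos_double_sin sin_double by (simp add: algebra_simps power2_eq_square)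
  ultimately show "reflection (root3 n k) x = dihedral_map n (False, k, 1) x"
    unfolding dihedral_map_def prod.case root_of_unity_def \<open>2 * pi * k / n = 2 * t\<close>
    by (simp add: vec_eq_iff forall_3 of_complex_part_def complex_part_def)
qed

lemma reflection_axis:
  assumes "a \<in> {axis 3 1, - axis 3 1}"
  shows "reflection a = dihedral_map n (True, 0, - 1)"
proof
  fix x
  have "reflection a x = x - (2 * x $ 3) *\<^sub>R axis 3 1"
    using assms by (auto simp: reflection_def inner_axis_axis inner_axis)
  also have "\<dots> = dihedral_map n (True, 0, - 1) x"
    by (simp add: dihedral_map_def root_of_unity_def of_complex_part_def complex_part_def
        vec_eq_iff forall_3 axis_def)
  finally show "reflection a x = dihedral_map n (True, 0, - 1) x" .
qed

lemma dihedral_map_comp: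
  "dihedral_map n (True, k, s) \<circ> dihedral_map n (b, l, t) = dihedral_map n (b, k + l, s * t)"
  "dihedral_map n (False, k, s) \<circ> dihedral_map n (b, l, t) = dihedral_map n (\<not> b, k - l, s * t)"
  by (auto simp: dihedral_map_def fun_eq_iff root_of_unity_add root_of_unity_diff mult.assoc)

lemma dihedral_map_id: "dihedral_map n (True, 0, 1) = id"
  by (auto simp: dihedral_map_def root_of_unity_def)

lemma inj_on_dihedral_map:
  assumes "n > 0"
  shows "inj_on (dihedral_map n) (UNIV \<times> {0..<int n} \<times> {1, - 1})"
proof (rule inj_onI)
  fix p p' assume p: "p \<in> (UNIV :: bool set) \<times> {0..<int n} \<times> {1, - 1 :: real}"
    "p' \<in> (UNIV :: bool set) \<times> {0..<int n} \<times> {1, - 1 :: real}" and eq: "dihedral_map n p = dihedral_map n p'"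
  obtain b k s b' k' s' where [simp]: "p = (b, k, s)" "p' = (b', k', s')"
    by (metis prod_cases3)
  define c c' where "c = root_of_unity n k" and "c' = root_of_unity n k'"
  have "c \<noteq> 0" "c' \<noteq> 0"
    by (simp_all add: c_def c'_def)
  have "dihedral_map n p (of_complex_part z 1) = dihedral_map n p' (of_complex_part z 1)" for z
    by (simp only: eq)
  then have "complex_part (dihedral_map n p (of_complex_part z 1)) = complex_part (dihedral_map n p' (of_complex_part z 1))"
     "dihedral_map n p (of_complex_part z 1) $ 3 = dihedral_map n p' (of_complex_part z 1) $ 3" for z
    by simp_all
  then have z: "(if b then c * z else - c * cnj z) = (if b' then c' * z else - c' * cnj z)"
    and s: "s = s'" for z
    by (simp_all add: dihedral_map_def flip: c_def c'_def cong: if_cong)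
  \<comment> \<open>At 1 both types of map are compared without conjugation; the value at
    \<open>\<i>\<close> then tells a rotation from a reflection.\<close>
  from z[of 1] z[of \<i>] \<open>c \<noteq> 0\<close> \<open>c' \<noteq> 0\<close> have "b = b'" "c = c'"
    by (auto split: if_splits)
  from \<open>c = c'\<close> have "k mod int n = k' mod int n"
    by (simp add: c_def c'_def root_of_unity_eq_iff[OF assms])
  with p have "k = k'"
    by simp
  with \<open>b = b'\<close> s show "p = p'"
    by simp
qed

lemma reflection_group_A1_I2:
  assumes "n > 0"
  shows "reflection_group (A1_I2 n) = dihedral_map n ` (UNIV \<times> {0..<int n} \<times> {1, - 1})"
proof -
  let ?W = "reflection_group (A1_I2 n)"
  have range: "dihedral_map n ` (UNIV \<times> {0..<int n} \<times> {1, - 1}) = dihedral_map n ` (UNIV \<times> UNIV \<times> {1, - 1})"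
  proof (intro equalityI subsetI)
    fix w assume "w \<in> dihedral_map n ` (UNIV \<times> UNIV \<times> {1, - 1})"
    then obtain b k s where "s \<in> {1, - 1}" "w = dihedral_map n (b, k mod int n, s)"
      by (auto simp: dihedral_map_cong[OF assms])
    then show "w \<in> dihedral_map n ` (UNIV \<times> {0..<int n} \<times> {1, - 1})"
      using assms by auto
  qed auto
  have "w \<in> dihedral_map n ` (UNIV \<times> UNIV \<times> {1, - 1})" if "w \<in> ?W" for w
    using that
  proof induction
    case id
    then show ?case
      using dihedral_map_id[of n] by (metis UNIV_I image_eqI insertI1 mem_Sigma_iff)
  next
    case (step a w)
    then obtain b l t where w: "t \<in> {1, - 1}" "w = dihedral_map n (b, l, t)"
      by auto
    from step.hyps(1) consider "a \<in> {axis 3 1, - axis 3 1}" | k where "a = root3 n k"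
      by (auto simp: A1_I2_eq[OF assms])
    then show ?case
    proof cases
      case 1
      then have "reflection a \<circ> w = dihedral_map n (b, l, - t)"
        by (simp add: w reflection_axis[where n = n] dihedral_map_comp)
      with w(1) show ?thesis
        by (intro image_eqI[where x = "(b, l, - t)"]) auto
    next
      case 2
      then have "reflection a \<circ> w = dihedral_map n (\<not> b, k - l, t)"
        by (simp add: w reflection_root3 dihedral_map_comp)
      with w(1) show ?thesis
        by (intro image_eqI[where x = "(\<not> b, k - l, t)"]) auto
    qed
  qed
  moreover have "dihedral_map n (b, k, s) \<in> ?W" if "s \<in> {1, - 1}" for b k s
  proof -
    have flat: "dihedral_map n (False, k, 1) \<circ> w \<in> ?W" if "w \<in> ?W" for k w
      using that reflection_group.step[of "root3 n k" "A1_I2 n" w]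
      by (simp add: A1_I2_eq[OF assms] reflection_root3)
    have vertical: "dihedral_map n (True, 0, - 1) \<circ> w \<in> ?W" if "w \<in> ?W" for w
      using that reflection_group.step[of "axis 3 1" "A1_I2 n" w]
      by (simp add: A1_I2_eq[OF assms] reflection_axis[where n = n])
    have one: "dihedral_map n (True, 0, 1) \<in> ?W"
      unfolding dihedral_map_id by (rule reflection_group.id)
    have F: "dihedral_map n (False, k, 1) \<in> ?W" for k
      using flat[OF one, of k] by (simp add: dihedral_map_comp)
    \<comment> \<open>A rotation is the product of the reflections in roots \<open>k\<close> and
      0.\<close>
    have T: "dihedral_map n (True, k, 1) \<in> ?W" for k
      using flat[OF F[of 0], of k] by (simp add: dihedral_map_comp)
    have "dihedral_map n (b, k, 1) \<in> ?W"
      using F T by (cases b) auto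
    then show ?thesis
      using that vertical[of "dihedral_map n (b, k, 1)"] by (auto simp: dihedral_map_comp)
  qed
  ultimately show ?thesis
    unfolding range by auto
qed

lemma card_reflection_group_A1_I2:
  assumes "n > 0"
  shows "card (reflection_group (A1_I2 n)) = 4 * n"
proof -
  have "card {1, - 1 :: real} = 2"
    by simp
  then show ?thesis
    by (simp add: reflection_group_A1_I2[OF assms] card_image[OF inj_on_dihedral_map[OF assms]]
        card_cartesian_product)
qed

section \<open>Exponents of the product of two dihedral root systems\<close>

definition reflection_product :: "'a::real_inner list \<Rightarrow> 'a \<Rightarrow> 'a" where
  "reflection_product as = foldr (\<lambda>a w. reflection a \<circ> w) as id"

lemma reflection_product_simps [simp]:
  "reflection_product [] = id"
  "reflection_product (a # as) = reflection a \<circ> reflection_product as"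
  by (simp_all add: reflection_product_def)

lemma reflection_add: "reflection a (x + y) = reflection a x + reflection a y"
  by (simp add: reflection_def inner_add_left distrib_left add_divide_distrib scaleR_add_left)

text \<open>A reflection in one plane fixes the other plane pointwise, so an interleaved product
  splits into its two subsequences, each keeping its own order.\<close>

lemma reflection_product_planes:
  assumes "distinct as" "set as \<subseteq> plane12 ` D \<union> plane34 ` D"
  shows "\<exists>bs cs. distinct bs \<and> distinct cs \<and> set bs \<subseteq> D \<and> set cs \<subseteq> D \<and>
    set as = plane12 ` set bs \<union> plane34 ` set cs \<and>
    (\<forall>x y. reflection_product as (plane12 x + plane34 y)
      = plane12 (reflection_product bs x) + plane34 (reflection_product cs y))"
  using assms
proof (induction as)
  case Nil
  show ?case
    by (intro exI[of _ "[]"]) simp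
next
  case (Cons a as)
  then obtain bs cs where IH: "distinct bs" "distinct cs" "set bs \<subseteq> D" "set cs \<subseteq> D"
    "set as = plane12 ` set bs \<union> plane34 ` set cs"
    "\<And>x y. reflection_product as (plane12 x + plane34 y)
      = plane12 (reflection_product bs x) + plane34 (reflection_product cs y)"
    by auto
  from Cons.prems consider b where "b \<in> D" "a = plane12 b" | b where "b \<in> D" "a = plane34 b"
    by auto
  then show ?case
  proof cases
    case 1
    then show ?thesis
      using IH Cons.prems by (intro exI[of _ "b # bs"] exI[of _ cs])
        (auto simp: reflection_add reflection_plane)
  next
    case 2
    then show ?thesis
      using IH Cons.prems by (intro exI[of _ bs] exI[of _ "b # cs"])
        (auto simp: reflection_add reflection_plane)
  qed
qed

lemma plane12_eq_iff: "plane12 x = plane12 y \<longleftrightarrow> x = y"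
  and plane34_eq_iff: "plane34 x = plane34 y \<longleftrightarrow> x = y"
  and plane12_eq_plane34_iff: "plane12 x = plane34 y \<longleftrightarrow> x = 0 \<and> y = 0"
  by (auto simp: plane12_def plane34_def vec_eq_iff forall_2 forall_4 vector_4)

definition rotation2 :: "real \<Rightarrow> real^2 \<Rightarrow> real^2" where
  "rotation2 \<phi> x = vector [cos \<phi> * x $ 1 - sin \<phi> * x $ 2, sin \<phi> * x $ 1 + cos \<phi> * x $ 2]"

text \<open>Two reflections compose to a rotation by twice the angle pi/n between their mirrors; the
  order of the factors gives the sign.\<close>

lemma reflection_product_I2_simple:
  assumes "n \<ge> 2" "distinct as" "set as = I2_simple n"
  obtains \<sigma> where "\<sigma> \<in> {1, - 1}" "reflection_product as = rotation2 (\<sigma> * (2 * pi / n))"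
proof -
  define c s where "c = cos (pi / n)" and "s = sin (pi / n)"
  define a b where "a = (axis 1 1 :: real^2)" and "b = - c *\<^sub>R axis 1 1 + s *\<^sub>R (axis 2 1 :: real^2)"
  have cs: "c * c + s * s = 1"
    using sin_cos_squared_add[of "pi / n"] by (simp add: c_def s_def power2_eq_square)
  have "s > 0"
    using sin_pi_over_pos[OF assms(1)] by (simp add: s_def)
  have "a $ 2 \<noteq> b $ 2"
    using \<open>s > 0\<close> by (simp add: a_def b_def axis_def)
  then have "a \<noteq> b"
    by auto
  have simple: "I2_simple n = {a, b}"
    by (simp add: I2_simple_def a_def b_def c_def s_def)
  have refl_a: "reflection a x = vector [- x $ 1, x $ 2]" for x
    by (simp add: reflection_def a_def inner_axis inner_axis_axis,
      simp add: vec_eq_iff forall_2 axis_def)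
  have "b \<bullet> b = 1"
    using cs by (simp add: b_def inner_vec_def sum_2 axis_def)
  moreover have "x \<bullet> b = s * x $ 2 - c * x $ 1" for x
    by (simp add: b_def inner_vec_def sum_2 axis_def)
  ultimately have refl_b: "reflection b x = vector [x $ 1 + 2 * (s * x $ 2 - c * x $ 1) * c,
      x $ 2 - 2 * (s * x $ 2 - c * x $ 1) * s]" for x
    by (simp add: reflection_def vec_eq_iff forall_2, simp add: b_def axis_def)
  have double: "cos (2 * pi / n) = 2 * c * c - 1" "cos (2 * pi / n) = 1 - 2 * s * s"
    "sin (2 * pi / n) = 2 * s * c"
    using cos_double_cos[of "pi / n"] cos_double_sin[of "pi / n"] sin_double[of "pi / n"]
    by (simp_all add: c_def s_def power2_eq_square)
  \<comment> \<open>The cosine is written with \<open>c\<close> in one coordinate and with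
    \<open>s\<close> in the other, as it arises from the reflections; the comparison is then pure
    ring algebra.\<close>
  have rot: "cos (2 * pi / n) * u - sin (2 * pi / n) * v = u * (2 * c * c - 1) - 2 * s * c * v"
    "sin (2 * pi / n) * u + cos (2 * pi / n) * v = 2 * s * c * u + v * (1 - 2 * s * s)" for u v
    using double by (simp_all add: mult.commute)
  have rot': "cos (2 * pi / n) * u + sin (2 * pi / n) * v = u * (2 * c * c - 1) + 2 * s * c * v"
    "cos (2 * pi / n) * v - sin (2 * pi / n) * u = v * (1 - 2 * s * s) - 2 * s * c * u" for u v
    using double by (simp_all add: mult.commute)
  have ab: "reflection a (reflection b x) = rotation2 (2 * pi / n) x" for x
    unfolding refl_a refl_b rotation2_def rot by (simp add: vec_eq_iff forall_2 algebra_simps)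
  have ba: "reflection b (reflection a x) = rotation2 (- (2 * pi / n)) x" for x
    unfolding refl_a refl_b rotation2_def cos_minus sin_minus
    using rot'(1)[of "x $ 1" "x $ 2"] rot'(2)[of "x $ 2" "x $ 1"] by (simp add: vec_eq_iff forall_2 algebra_simps)
  have "length as = 2"
    using assms(2,3) \<open>a \<noteq> b\<close> distinct_card[of as] by (simp add: simple)
  then obtain p q where as: "as = [p, q]"
    by (auto simp: length_Suc_conv numeral_2_eq_2)
  with assms(3) have "p = a \<and> q = b \<or> p = b \<and> q = a"
    unfolding simple by (auto simp: doubleton_eq_iff)
  then show thesis
  proof
    assume "p = a \<and> q = b"
    then have "reflection_product as = rotation2 (1 * (2 * pi / n))"
      by (auto simp: as ab)
    then show thesis
      by (intro that[of 1]) auto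
  next
    assume "p = b \<and> q = a"
    then have "reflection_product as = rotation2 (- 1 * (2 * pi / n))"
      by (auto simp: as ba)
    then show thesis
      by (intro that[of "- 1"]) auto
  qed
qed

definition rotation4 :: "real \<Rightarrow> real \<Rightarrow> real^4 \<Rightarrow> real^4" where
  "rotation4 \<phi> \<psi> x = vector [cos \<phi> * x $ 1 - sin \<phi> * x $ 2, sin \<phi> * x $ 1 + cos \<phi> * x $ 2,
    cos \<psi> * x $ 3 - sin \<psi> * x $ 4, sin \<psi> * x $ 3 + cos \<psi> * x $ 4]"

lemma coxeter_element_I2_I2:
  assumes "n \<ge> 2" "w \<in> coxeter_elements (I2_I2_simple n)"
  obtains \<sigma> \<tau> where "\<sigma> \<in> {1, - 1}" "\<tau> \<in> {1, - 1}"
    "w = rotation4 (\<sigma> * (2 * pi / n)) (\<tau> * (2 * pi / n))"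
proof -
  obtain as where as: "distinct as" "set as = I2_I2_simple n" "w = reflection_product as"
    using assms(2) by (auto simp: coxeter_elements_def reflection_product_def)
  then obtain bs cs where bc: "distinct bs" "distinct cs" "set bs \<subseteq> I2_simple n" "set cs \<subseteq> I2_simple n"
    "set as = plane12 ` set bs \<union> plane34 ` set cs"
    "\<And>x y. w (plane12 x + plane34 y)
      = plane12 (reflection_product bs x) + plane34 (reflection_product cs y)"
    using reflection_product_planes[of as "I2_simple n"] unfolding I2_I2_simple_def by auto
  \<comment> \<open>The two coordinate planes meet only in 0, so nonzero simple roots determine
    uniquely which list each factor belongs to, and both lists exhaust
    \<open>I2_simple n\<close>.\<close>
  have "0 \<notin> I2_simple n"
  proof -
    have "planar_root n k \<noteq> 0" for k
      by (auto simp: planar_root_def vec_eq_iff forall_2) (metis sin_zero_abs_cos_one abs_zero zero_neq_one)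
    then show ?thesis
      using assms(1) by (auto simp: I2_simple_eq)
  qed
  with bc as(2) have "set bs = I2_simple n" "set cs = I2_simple n"
    unfolding I2_I2_simple_def set_eq_iff Un_iff image_iff
    by (metis plane12_eq_iff plane12_eq_plane34_iff plane34_eq_iff subsetD)+
  then obtain \<sigma> \<tau> where \<sigma>\<tau>: "\<sigma> \<in> {1, - 1}" "reflection_product bs = rotation2 (\<sigma> * (2 * pi / n))"
    "\<tau> \<in> {1, - 1}" "reflection_product cs = rotation2 (\<tau> * (2 * pi / n))"
    using reflection_product_I2_simple[OF assms(1)] bc(1,2) by metis
  have "w x = rotation4 (\<sigma> * (2 * pi / n)) (\<tau> * (2 * pi / n)) x" for x
  proof -
    have x: "x = plane12 (vector [x $ 1, x $ 2]) + plane34 (vector [x $ 3, x $ 4])"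
      by (simp add: plane12_def plane34_def vec_eq_iff forall_4 vector_4)
    have "w x = plane12 (reflection_product bs (vector [x $ 1, x $ 2]))
        + plane34 (reflection_product cs (vector [x $ 3, x $ 4]))"
      by (subst x) (rule bc(6))
    then show ?thesis
      by (simp add: \<sigma>\<tau> rotation2_def rotation4_def plane12_def plane34_def vec_eq_iff forall_4 vector_4)
  qed
  with \<sigma>\<tau> show thesis
    using that by blast
qed

section \<open>Order and characteristic polynomial of a double rotation\<close>

lemma rotation4_comp: "rotation4 \<phi> \<psi> (rotation4 \<phi>' \<psi>' x) = rotation4 (\<phi> + \<phi>') (\<psi> + \<psi>') x"
  by (simp add: rotation4_def vec_eq_iff forall_4 vector_4 cos_add sin_add algebra_simps)

lemma rotation4_funpow: "rotation4 \<phi> \<psi> ^^ k = rotation4 (k * \<phi>) (k * \<psi>)"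
proof (induction k)
  case 0
  show ?case
    by (auto simp: rotation4_def vec_eq_iff forall_4 vector_4)
next
  case (Suc k)
  then show ?case
    by (simp add: fun_eq_iff rotation4_comp distrib_right)
qed

lemma rotation4_eq_id_iff: "rotation4 \<phi> \<psi> = id \<longleftrightarrow> cos \<phi> = 1 \<and> cos \<psi> = 1"
proof
  assume id: "rotation4 \<phi> \<psi> = id"
  have "rotation4 \<phi> \<psi> (axis 1 1) $ 1 = 1" "rotation4 \<phi> \<psi> (axis 3 1) $ 3 = 1"
    unfolding id by (simp_all add: axis_def)
  then show "cos \<phi> = 1 \<and> cos \<psi> = 1"
    by (simp add: rotation4_def vector_4 axis_def)
next
  assume cos: "cos \<phi> = 1 \<and> cos \<psi> = 1"
  then have "sin \<phi> = 0" "sin \<psi> = 0"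
    using sin_cos_squared_add[of \<phi>] sin_cos_squared_add[of \<psi>] by simp_all
  with cos show "rotation4 \<phi> \<psi> = id"
    by (auto simp: rotation4_def vec_eq_iff forall_4 vector_4)
qed

lemma cos_multiple_eq_1_iff:
  fixes n k :: nat
  assumes "n > 0"
  shows "cos (real k * (2 * pi / n)) = 1 \<longleftrightarrow> n dvd k"
proof -
  have "root_of_unity n (int k) = 1 \<longleftrightarrow> cos (real k * (2 * pi / n)) = 1"
  proof -
    have "root_of_unity n (int k) = cis (real k * (2 * pi / n))"
      by (simp add: root_of_unity_def mult_ac)
    moreover have "sin t = 0" if "cos t = 1" for t :: real
      using that sin_cos_squared_add[of t] by simp
    ultimately show ?thesis
      by (auto simp: complex_eq_iff)
  qed
  then show ?thesis
    by (simp add: root_of_unity_eq_1_iff[OF assms])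
qed

text \<open>The power criterion sees only cosines, which are even, so the senses of rotation do not
  affect the order.\<close>

lemma map_order_rotation4:
  assumes "n > 0" "\<sigma> \<in> {1, - 1}" "\<tau> \<in> {1, - 1}"
  shows "map_order (rotation4 (\<sigma> * (2 * pi / n)) (\<tau> * (2 * pi / n))) = n"
proof -
  have "cos (real k * (\<sigma> * (2 * pi / n))) = cos (real k * (2 * pi / n))"
    if "\<sigma> \<in> {1, - 1}" for k and \<sigma> :: real
    using that by auto
  then have "rotation4 (\<sigma> * (2 * pi / n)) (\<tau> * (2 * pi / n)) ^^ k = id \<longleftrightarrow> n dvd k" for k
    using assms by (simp only: rotation4_funpow rotation4_eq_id_iff cos_multiple_eq_1_iff conj_absorb)
  then show ?thesis
    unfolding map_order_def using assms(1) by (intro Least_equality) (auto dest: dvd_imp_le)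
qed

lemma det_block_4:
  fixes A :: "'a::comm_ring_1^4^4"
  assumes "A $ 1 $ 3 = 0" "A $ 1 $ 4 = 0" "A $ 2 $ 3 = 0" "A $ 2 $ 4 = 0"
    "A $ 3 $ 1 = 0" "A $ 3 $ 2 = 0" "A $ 4 $ 1 = 0" "A $ 4 $ 2 = 0"
  shows "det A = (A $ 1 $ 1 * A $ 2 $ 2 - A $ 1 $ 2 * A $ 2 $ 1)
    * (A $ 3 $ 3 * A $ 4 $ 4 - A $ 3 $ 4 * A $ 4 $ 3)"
proof -
  \<comment> \<open>Side conditions for expanding the Leibniz sum by the image of one index at a
    time.\<close>
  have f1234: "finite {2::4, 3, 4}" "1 \<notin> {2::4, 3, 4}"
    by auto
  have f234: "finite {3::4, 4}" "2 \<notin> {3::4, 4}"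
    by auto
  have f34: "finite {4::4}" "3 \<notin> {4::4}"
    by auto
  show ?thesis
    unfolding det_def UNIV_4
    unfolding sum_over_permutations_insert[OF f1234]
    unfolding sum_over_permutations_insert[OF f234]
    unfolding sum_over_permutations_insert[OF f34]
    unfolding permutes_sing
    by (simp add: sign_swap_id permutation_swap_id permutation_compose sign_compose sign_id
        swap_id_eq assms algebra_simps)
qed

text \<open>The left side is the characteristic determinant of a plane rotation, X^2 - 2 cos(phi) X
  + 1.\<close>

lemma quadratic_cis:
  "[:- complex_of_real (cos \<phi>), 1:] * [:- complex_of_real (cos \<phi>), 1:]
    - [:complex_of_real (sin \<phi>):] * [:- complex_of_real (sin \<phi>):] = [:- cis \<phi>, 1:] * [:- cis (- \<phi>), 1:]"
proof -
  have "cis \<phi> * cis (- \<phi>) = 1"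
    by (simp add: cis_mult)
  moreover have "complex_of_real (cos \<phi>) * complex_of_real (cos \<phi>) + complex_of_real (sin \<phi>) * complex_of_real (sin \<phi>) = 1"
    using sin_cos_squared_add[of \<phi>] by (metis add.commute of_real_1 of_real_add of_real_mult power2_eq_square)
  moreover have "cis \<phi> + cis (- \<phi>) = 2 * complex_of_real (cos \<phi>)"
    by (simp add: complex_eq_iff)
  ultimately show ?thesis
    by (simp add: algebra_simps)
qed

lemma charpoly_rotation4:
  "charpoly (rotation4 \<phi> \<psi>) = ([:- cis \<phi>, 1:] * [:- cis (- \<phi>), 1:]) * ([:- cis \<psi>, 1:] * [:- cis (- \<psi>), 1:])"
  unfolding charpoly_def
  by (subst det_block_4)
    (simp_all add: matrix_def rotation4_def vector_4 axis_def quadratic_cis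
      del: mult_pCons_left mult_pCons_right)

lemma order_linear: "order a [:- b, 1:] = (if a = b then 1 else 0 :: nat)" for a b :: complex
  using order_power_n_n[of b 1] by (auto intro!: order_0I)

lemma exponents_rotation4:
  assumes "n \<ge> 2" "\<sigma> \<in> {1, - 1}" "\<tau> \<in> {1, - 1}"
  shows "exponents (rotation4 (\<sigma> * (2 * pi / n)) (\<tau> * (2 * pi / n))) = {#1, 1, n - 1, n - 1#}"
proof -
  have "n > 0"
    using assms(1) by simp
  let ?\<omega> = "root_of_unity n"
  \<comment> \<open>Changing the sign of the angle only swaps the two linear factors.\<close>
  have factor: "[:- cis (\<sigma> * (2 * pi / n)), 1:] * [:- cis (- (\<sigma> * (2 * pi / n))), 1:]
      = [:- ?\<omega> 1, 1:] * [:- ?\<omega> (- 1), 1:]" if "\<sigma> \<in> {1, - 1}" for \<sigma> :: real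
  proof -
    have "?\<omega> 1 = cis (2 * pi / n)" "?\<omega> (- 1) = cis (- (2 * pi / n))"
      by (simp_all add: root_of_unity_def)
    with that show ?thesis
      by (auto simp: mult.commute)
  qed
  \<comment> \<open>Each plane contributes one factor for the index 1 and one for -1, which is n - 1
    modulo n. The two terms are added, so that for n = 2 the index 1 gets multiplicity 4.\<close>
  have mult: "order (exp (2 * pi * \<i> * m / n)) (charpoly (rotation4 (\<sigma> * (2 * pi / n)) (\<tau> * (2 * pi / n))))
      = (if m = 1 then 2 else 0) + (if m = n - 1 then 2 else 0)" if "m < n" for m :: nat
  proof -
    have "exp (2 * pi * \<i> * m / n) = ?\<omega> (int m)"
      by (simp add: root_of_unity_def cis_conv_exp mult_ac)
    moreover have "?\<omega> (int m) = ?\<omega> 1 \<longleftrightarrow> m = 1"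
      using that assms(1) by (auto simp: root_of_unity_eq_iff[OF \<open>n > 0\<close>])
    moreover have "?\<omega> (int m) = ?\<omega> (- 1) \<longleftrightarrow> m = n - 1"
      using that assms(1) by (auto simp: root_of_unity_eq_iff[OF \<open>n > 0\<close>] zmod_minus1)
    ultimately show ?thesis
      unfolding charpoly_rotation4 factor[OF assms(2)] factor[OF assms(3)]
      by (simp add: order_mult order_linear del: mult_pCons_left mult_pCons_right)
  qed
  have "count (exponents (rotation4 (\<sigma> * (2 * pi / n)) (\<tau> * (2 * pi / n)))) x
      = count {#1, 1, n - 1, n - 1#} x" for x
  proof -
    have "count (exponents (rotation4 (\<sigma> * (2 * pi / n)) (\<tau> * (2 * pi / n)))) x
        = (\<Sum>m<n. if x = m then (if m = 1 then 2 else 0) + (if m = n - 1 then 2 else 0) else 0)"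
      unfolding exponents_def map_order_rotation4[OF \<open>n > 0\<close> assms(2,3)] Let_def count_sum
      by (rule sum.cong[OF refl], subst mult) (simp_all only: lessThan_iff count_replicate_mset)
    also have "\<dots> = count {#1, 1, n - 1, n - 1#} x"
      using assms(1) by (auto simp: sum.delta)
    finally show ?thesis .
  qed
  then show ?thesis
    by (rule multiset_eqI)
qed

theorem mainTheorem2:
  fixes n :: nat and \<Phi> :: "(real^3) set" and C :: "(real^3) set"
    and cones :: "(real^3) set set"
  assumes "n \<ge> 2"
    and "\<Phi> = A1_I2 n"
    and "C \<in> weyl_chambers \<Phi>"
    and "cones = regions (walls \<Phi> C)"
  shows "card (reflection_group \<Phi>) = 4 * n
    \<and> card (walls \<Phi> C) = 3
    \<and> card cones = 8
    \<and> (\<forall>K\<in>cones. open K \<and> (\<forall>x\<in>K. \<forall>c>0. c *\<^sub>R x \<in> K))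
    \<and> (\<forall>K\<in>cones. uminus ` K \<in> cones \<and> uminus ` K \<noteq> K)
    \<and> card {{K, uminus ` K} |K. K \<in> cones} = 4
    \<and> (\<forall>K\<in>cones. num_chambers \<Phi> (uminus ` K) = num_chambers \<Phi> K)
    \<and> (\<forall>S\<subseteq>cones. (\<forall>K\<in>cones. K \<in> S \<longleftrightarrow> uminus ` K \<notin> S) \<longrightarrow>
         image_mset (num_chambers \<Phi>) (mset_set S) = {#1, 1, n - 1, n - 1#})
    \<and> 4 * n = 2 * (1 + (n - 1) + 1 + (n - 1))
    \<and> (\<forall>w\<in>coxeter_elements (I2_I2_simple n). exponents w = {#1, 1, n - 1, n - 1#})"
proof -
  have "n > 0"
    using assms(1) by simp
  \<comment> \<open>Counting sectors from the given chamber puts it at offset 0, so all lemmas on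
    \<open>chamber n j (0, s)\<close> apply to an arbitrary chamber.\<close>
  obtain j s where s: "s \<in> {1, - 1}" "C = chamber n j (0, s)"
    using weyl_chamber_eq_chamber[OF \<open>n > 0\<close>] assms(2,3) by metis
  have walls: "walls \<Phi> C = root_hyperplanes (basis3 n j)"
    unfolding s(2) assms(2) by (rule walls_chamber[OF assms(1) s(1)])
  have cones: "cones = range (octant n j)"
    unfolding assms(4) walls by (rule regions_basis3[OF assms(1)])
  have antipodal: "uminus ` K \<in> cones" "uminus ` K \<noteq> K" "uminus ` uminus ` K = K" if K: "K \<in> cones" for K
  proof -
    obtain t where t: "K = octant n j t"
      using K cones by blast
    have "opposite t \<noteq> t"
      by (metis fst_opposite)
    then show "uminus ` K \<in> cones" "uminus ` K \<noteq> K" "uminus ` uminus ` K = K"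
      by (simp_all add: t cones uminus_octant opposite_opposite inj_eq[OF inj_octant[OF assms(1)]])
  qed
  have card_cones: "card cones = 8"
    unfolding cones by (simp add: card_image[OF inj_octant[OF assms(1)]])
  then have "finite cones"
    by (metis card.infinite zero_neq_numeral)
  then have pairs: "card {{K, uminus ` K} |K. K \<in> cones} = 4"
    using card_involution_pairs[of cones "image uminus"] antipodal card_cones by simp
  have "card (reflection_group \<Phi>) = 4 * n"
    unfolding assms(2) by (rule card_reflection_group_A1_I2[OF \<open>n > 0\<close>])
  moreover have "card (walls \<Phi> C) = 3"
    unfolding walls by (rule card_hyperplanes_basis3[OF assms(1)])
  moreover have "\<forall>K\<in>cones. open K \<and> (\<forall>x\<in>K. \<forall>c>0. c *\<^sub>R x \<in> K)"
    unfolding cones using open_octant[OF assms(1)] octant_cone by simp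
  moreover have "\<forall>K\<in>cones. uminus ` K \<in> cones \<and> uminus ` K \<noteq> K"
    using antipodal(1,2) by simp
  moreover have "\<forall>K\<in>cones. num_chambers \<Phi> (uminus ` K) = num_chambers \<Phi> K"
    unfolding cones assms(2) by (simp add: uminus_octant num_chambers_opposite[OF assms(1)])
  moreover have "\<forall>S\<subseteq>cones. (\<forall>K\<in>cones. K \<in> S \<longleftrightarrow> uminus ` K \<notin> S) \<longrightarrow>
      image_mset (num_chambers \<Phi>) (mset_set S) = {#1, 1, n - 1, n - 1#}"
    unfolding cones assms(2) by (intro allI impI) (rule octant_transversals[OF assms(1)])
  moreover have "4 * n = 2 * (1 + (n - 1) + 1 + (n - 1))"
    using assms(1) by simp
  moreover have "\<forall>w\<in>coxeter_elements (I2_I2_simple n). exponents w = {#1, 1, n - 1, n - 1#}"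
  proof
    fix w assume "w \<in> coxeter_elements (I2_I2_simple n)"
    then show "exponents w = {#1, 1, n - 1, n - 1#}"
      by (rule coxeter_element_I2_I2[OF assms(1)]) (simp only: exponents_rotation4[OF assms(1)])
  qed
  ultimately show ?thesis
    using card_cones pairs by (intro conjI)
qed

end
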